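(* For each positive integer $n$ let $\mathbf A=\mathbf 1_{n\times n}$ be the all-one matrix of size $n\times n$. Then, as $n\to\infty$, $$\frac{\mathrm{perm}(\mathbf A)}{\mathrm{perm}_{\mathrm B}(\mathbf A)}\sim\sqrt{\frac{2\pi n}{\mathrm e}},\qquad \frac{\mathrm{perm}(\mathbf A)}{\mathrm{perm}_{\mathrm B,2}(\mathbf A)}\sim\sqrt[4]{\frac{\pi n}{\mathrm e}},\qquad \frac{\mathrm{perm}_{\mathrm B,2}(\mathbf A)}{\mathrm{perm}_{\mathrm B}(\mathbf A)}\sim\sqrt2\cdot\sqrt[4]{\frac{\pi n}{\mathrm e}}.$$
   Context: Notation: $[n]=\{1,\dots,n\}$; $\mathcal S_n$ is the group of permutations of $[n]$; $\mathrm{perm}(\mathbf B)=\sum_{\sigma\in\mathcal S_m}\prod_{i\in[m]}b_{i,\sigma(i)}$ for an $m\times m$ matrix $\mathbf B$; $a(n)\sim b(n)$ means $\lim_{n\to\infty}a(n)/b(n)=1$; $\mathrm e$ is Euler's number. Degree-$M$ Bethe permanent of a non-negative matrix $\mathbf A=(a_{i,j})\in\mathbb R^{n\times n}$: for a positive integer $M$, let $\tilde\Phi_M$ be the set of all families $\tilde{\mathbf P}=\{\tilde{\mathbf P}^{(i,j)}\}_{i,j\in[n]}$ of $M\times M$ permutation matrices (so $|\tilde\Phi_M|=(M!)^{n^2}$). For $\tilde{\mathbf P}\in\tilde\Phi_M$ let $\mathbf A^{\uparrow\tilde{\mathbf P}}$ be the $(Mn)\times(Mn)$ block matrix whose $(i,j)$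 block is $a_{i,j}\tilde{\mathbf P}^{(i,j)}$. Then $$\mathrm{perm}_{\mathrm{B},M}(\mathbf A)=\Bigl(\frac{1}{|\tilde\Phi_M|}\sum_{\tilde{\mathbf P}\in\tilde\Phi_M}\mathrm{perm}(\mathbf A^{\uparrow\tilde{\mathbf P}})\Bigr)^{1/M}.$$ Bethe permanent: $\mathrm{perm}_{\mathrm B}(\mathbf A)=\limsup_{M\to\infty}\mathrm{perm}_{\mathrm B,M}(\mathbf A)$. (The Bethe permanent was originally introduced through an optimization problem coming from the Bethe approximation; the limsup expression is a known equivalent combinatorial characterization and is used here as the definition.) *)

theory Defs
  imports
    "Jordan_Normal_Form.Matrix"
    "HOL-Combinatorics.Permutations"
    "HOL-Library.FuncSet"
    "HOL-Library.Extended_Real"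
    "HOL-Library.Landau_Symbols"
begin

text \<open>Matrices are those of \<^theory>\<open>Jordan_Normal_Form.Matrix\<close>, so rows and columns of an
  \<open>n \<times> n\<close> matrix are indexed by \<open>0, \<dots>, n - 1\<close> instead of \<open>1, \<dots>, n\<close>.\<close>

definition permanent :: "'a :: comm_semiring_1 mat \<Rightarrow> 'a" where
  "permanent B = (if dim_row B = dim_col B
     then (\<Sum>\<sigma> | \<sigma> permutes {0..<dim_row B}. \<Prod>i\<in>{0..<dim_row B}. B $$ (i, \<sigma> i))
     else 0)"

definition perm_matrices :: "nat \<Rightarrow> 'a :: zero_neq_one mat set" where
  "perm_matrices M =
     {mat M M (\<lambda>(i, j). if j = \<sigma> i then 1 else 0) | \<sigma>. \<sigma> permutes {0..<M}}"

text \<open>The families are extensional functions, so that the set below is finite and each family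
  \<open>(P (i, j))\<^sub>i\<^sub>,\<^sub>j\<^sub><\<^sub>n\<close> is counted once.\<close>

definition perm_matrix_families :: "nat \<Rightarrow> nat \<Rightarrow> (nat \<times> nat \<Rightarrow> 'a :: zero_neq_one mat) set" where
  "perm_matrix_families n M = ({0..<n} \<times> {0..<n}) \<rightarrow>\<^sub>E perm_matrices M"

text \<open>The block matrix whose \<open>(i, j)\<close> block is \<open>A $$ (i, j) \<cdot>\<^sub>m P (i, j)\<close>, all blocks being \<open>M \<times> M\<close>:
  row \<open>r\<close> is row \<open>r mod M\<close> of block row \<open>r div M\<close>, and likewise for columns.\<close>

definition lift_mat :: "nat \<Rightarrow> 'a :: semiring_1 mat \<Rightarrow> (nat \<times> nat \<Rightarrow> 'a mat) \<Rightarrow> 'a mat" where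
  "lift_mat M A P = mat (M * dim_row A) (M * dim_col A)
     (\<lambda>(r, c). (A $$ (r div M, c div M) \<cdot>\<^sub>m P (r div M, c div M)) $$ (r mod M, c mod M))"

text \<open>Meaningful for square non-negative \<open>A\<close> and \<open>M > 0\<close>.\<close>

definition bethe_perm_deg :: "nat \<Rightarrow> real mat \<Rightarrow> real" where
  "bethe_perm_deg M A = root M
     ((\<Sum>P\<in>perm_matrix_families (dim_row A) M. permanent (lift_mat M A P)) /
      real (card (perm_matrix_families (dim_row A) M :: (nat \<times> nat \<Rightarrow> real mat) set)))"

text \<open>The limit superior is formed in the extended reals. For non-negative \<open>A\<close> it is finite, as each
  term with \<open>M > 0\<close> is at most the product of the row sums of \<open>A\<close>, so the conversion to \<open>real\<close>
  loses nothing.\<close>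

definition bethe_perm :: "real mat \<Rightarrow> real" where
  "bethe_perm A = real_of_ereal (limsup (\<lambda>M. ereal (bethe_perm_deg M A)))"

definition all_one_mat :: "nat \<Rightarrow> real mat" where
  "all_one_mat n = mat n n (\<lambda>_. 1)"

end

theory Submission
  imports Defs "HOL-Analysis.Analysis" "HOL-Real_Asymp.Real_Asymp"
begin

text \<open>
  Averaging the permanent of the lift over all families of permutation matrices turns a permutation
  \<open>\<sigma>\<close> of \<open>{0..<M n}\<close> with block counts \<open>k\<^sub>i\<^sub>j\<close> into the weight \<open>\<Prod>\<^sub>i\<^sub>j (M - k\<^sub>i\<^sub>j)! / M!\<close>, and there are
  \<open>(M!)\<^bsup>2n\<^esup> / \<Prod>\<^sub>i\<^sub>j k\<^sub>i\<^sub>j!\<close> permutations with given counts. There are at most \<open>(M + 1)\<^bsup>n\<^sup>2\<^esup>\<close> count matrices, and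
  moving a unit from a larger to a smaller entry of a row never decreases \<open>\<Prod>\<^sub>j (M - k\<^sub>j)! / k\<^sub>j!\<close>, so the
  balanced matrix \<open>k\<^sub>i\<^sub>j = M / n\<close> dominates; hence the Bethe permanent is
  \<open>n\<^bsup>n\<^esup> (1 - 1/n)\<^bsup>n (n - 1)\<^esup>\<close>, to be compared with Stirling's formula.

  For \<open>M = 2\<close> the weight of a block row is \<open>1/2\<close> or \<open>1/4\<close> according to whether \<open>\<sigma>\<close> keeps its two rows in one
  column block. Expanding \<open>\<Prod>\<^sub>i (1 + e\<^sub>i) / 4\<close> over the sets of such block rows gives the average
  \<open>(n!)\<^sup>2\<close> times the coefficient of \<open>x\<^sup>n\<close> in \<open>exp (x/2) / sqrt (1 - x)\<close>, which Tannery's theorem and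
  the asymptotics of the central binomial coefficients estimate.
\<close>

hide_const (open) Finite_Cartesian_Product.mat Finite_Cartesian_Product.transpose

section \<open>Counting permutations with prescribed fibres\<close>

text \<open>Induction on \<open>X\<close> with \<open>g\<close> varying. The image \<open>b\<close>
  of the new point \<open>a\<close> must lie in the fibre of \<open>g\<close> over
  \<open>c a\<close>, which has one point more than the corresponding fibre of \<open>c\<close> in
  \<open>S\<close>. Splitting off \<open>transpose a b\<close> leaves a permutation \<open>p\<close>
  of \<open>S\<close>, to be counted for \<open>g \<circ> transpose a b\<close>, whose fibres in
  \<open>S\<close> again match those of \<open>c\<close>.\<close>

lemma card_permutes_fibres:
  fixes c g :: "'a \<Rightarrow> 'b"
  assumes "finite X" "finite J" "c ` X \<subseteq> J"
    and "\<And>j. j \<in> J \<Longrightarrow> card {x\<in>X. g x = j} = card {x\<in>X. c x = j}"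
  shows "card {\<sigma>. \<sigma> permutes X \<and> (\<forall>x\<in>X. g (\<sigma> x) = c x)} = (\<Prod>j\<in>J. fact (card {x\<in>X. c x = j}))"
  using assms(1,3,4)
proof (induction X arbitrary: g rule: finite_induct)
  case empty
  then show ?case by simp
next
  case (insert a S)
  let ?N = "\<lambda>j. card {x\<in>S. c x = j}"
  define Q where "Q b = {p. p permutes S \<and> (\<forall>x\<in>S. g (transpose a b (p x)) = c x)}" for b
  define B where "B = {b \<in> insert a S. g b = c a}"
  have finQ: "finite (Q b)" for b
    unfolding Q_def by (rule finite_subset[OF _ finite_permutations[OF insert.hyps(1)]]) auto
  have finB: "finite B" unfolding B_def using insert.hyps by auto
  have ca: "c a \<in> J" using insert.prems by auto
  have set_eq: "{\<sigma>. \<sigma> permutes insert a S \<and> (\<forall>x\<in>insert a S. g (\<sigma> x) = c x)}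
      = (\<lambda>(b, p). transpose a b \<circ> p) ` Sigma B Q" (is "?L = ?R")
  proof
    show "?L \<subseteq> ?R"
    proof
      fix \<sigma> assume \<sigma>: "\<sigma> \<in> ?L"
      let ?q = "transpose a (\<sigma> a) \<circ> \<sigma>"
      from \<sigma> have q: "?q permutes S" by (intro permutes_insert_lemma) auto
      have b: "\<sigma> a \<in> B" using \<sigma> permutes_in_image[of \<sigma> "insert a S" a] by (auto simp: B_def)
      have "?q \<in> Q (\<sigma> a)" using \<sigma> q by (auto simp: Q_def)
      moreover have "\<sigma> = transpose a (\<sigma> a) \<circ> ?q" by (simp add: fun_eq_iff)
      ultimately show "\<sigma> \<in> ?R" using b by (intro image_eqI[of _ _ "(\<sigma> a, ?q)"]) auto
    qed
    show "?R \<subseteq> ?L"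
    proof clarify
      fix b p assume b: "b \<in> B" and p: "p \<in> Q b"
      have "p permutes S" using p by (simp add: Q_def)
      then have pa: "p a = a" using insert.hyps by (simp add: permutes_not_in)
      have "transpose a b \<circ> p permutes insert a S"
        using permutes_insert[of a S] b \<open>p permutes S\<close> by (auto simp: B_def)
      then show "transpose a b \<circ> p permutes insert a S \<and>
          (\<forall>x\<in>insert a S. g ((transpose a b \<circ> p) x) = c x)"
        using p b pa by (auto simp: Q_def B_def)
    qed
  qed
  have inj: "inj_on (\<lambda>(b, p). transpose a b \<circ> p) (Sigma B Q)"
  proof (rule inj_onI, clarify)
    fix b p b' p' assume *: "p \<in> Q b" "p' \<in> Q b'" "transpose a b \<circ> p = transpose a b' \<circ> p'"
    have "p a = a" "p' a = a" using * insert.hyps by (auto simp: Q_def permutes_not_in)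
    then have bb: "b = b'" using fun_cong[OF *(3), of a] by simp
    have "transpose a b \<circ> (transpose a b \<circ> p) = transpose a b \<circ> (transpose a b \<circ> p')"
      using * bb by simp
    then show "b = b' \<and> p = p'" using bb by (simp add: o_assoc)
  qed
  have cardQ: "card (Q b) = (\<Prod>j\<in>J. fact (?N j))" if "b \<in> B" for b
  proof -
    have "card {x\<in>S. (g \<circ> transpose a b) x = j} = ?N j" if j: "j \<in> J" for j
    proof -
      \<comment> \<open>The transposition puts \<open>a\<close> in the place of the used value
        \<open>b\<close>; as \<open>g b = c a\<close>, only the fibre over \<open>c a\<close> loses
        a point.\<close>
      have "bij_betw (transpose a b) {x\<in>S. (g \<circ> transpose a b) x = j} {y\<in>insert a S - {b}. g y = j}"
        using \<open>b \<in> B\<close> insert.hyps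
        by (intro bij_betwI[where g = "transpose a b"]) (auto simp: B_def Transposition.transpose_def split: if_splits)
      then have "card {x\<in>S. (g \<circ> transpose a b) x = j} = card {y\<in>insert a S - {b}. g y = j}"
        by (rule bij_betw_same_card)
      also have "{y\<in>insert a S - {b}. g y = j} = {y\<in>insert a S. g y = j} - {b}" by auto
      also have "card \<dots> = card {x\<in>insert a S. c x = j} - (if c a = j then 1 else 0)"
        using insert.prems(2)[OF j] \<open>b \<in> B\<close> by (auto simp: B_def)
      also have "{x\<in>insert a S. c x = j} = (if c a = j then insert a {x\<in>S. c x = j} else {x\<in>S. c x = j})"
        by auto
      finally show ?thesis using insert.hyps by (auto split: if_splits)
    qed
    from insert.IH[of "g \<circ> transpose a b", OF _ this] insert.prems
    show ?thesis by (auto simp: Q_def)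
  qed
  have N': "card {x\<in>insert a S. c x = j} = (if j = c a then Suc (?N j) else ?N j)" for j
  proof -
    have "{x\<in>insert a S. c x = j} = (if c a = j then insert a {x\<in>S. c x = j} else {x\<in>S. c x = j})"
      by auto
    then show ?thesis using insert.hyps by auto
  qed
  have cardB: "card B = Suc (?N (c a))"
    using insert.prems(2)[OF ca] N'[of "c a"] by (simp add: B_def)
  have "card {\<sigma>. \<sigma> permutes insert a S \<and> (\<forall>x\<in>insert a S. g (\<sigma> x) = c x)} = card (Sigma B Q)"
    unfolding set_eq by (rule card_image[OF inj])
  also have "\<dots> = (\<Sum>b\<in>B. card (Q b))" using finB finQ by (simp add: card_SigmaI)
  also have "\<dots> = Suc (?N (c a)) * (\<Prod>j\<in>J. fact (?N j))" using cardQ cardB by simp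
  also have "\<dots> = (\<Prod>j\<in>J. fact (card {x\<in>insert a S. c x = j}))"
    unfolding N' using \<open>finite J\<close> ca
    by (subst (1 2) prod.remove[of _ "c a"]) (auto simp: algebra_simps intro!: prod.cong)
  finally show ?case .
qed

text \<open>Labels reduce this to \<open>card_permutes_fibres\<close>: \<open>a r\<close> and
  \<open>b r\<close> carry \<open>Some r\<close>, all remaining points \<open>None\<close>. The
  fibres over \<open>Some r\<close> are singletons, and the \<open>None\<close> fibre contributes
  the factorial.\<close>

lemma card_permutes_extending:
  assumes "finite X" and a: "inj_on a R" "a ` R \<subseteq> X" and b: "inj_on b R" "b ` R \<subseteq> X"
  shows "card {\<tau>. \<tau> permutes X \<and> (\<forall>r\<in>R. \<tau> (a r) = b r)} = fact (card X - card R)"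
proof -
  have finR: "finite R" by (rule finite_imageD[OF finite_subset[OF a(2) assms(1)] a(1)])
  define c where "c x = (if x \<in> a ` R then Some (inv_into R a x) else None)" for x
  define g where "g x = (if x \<in> b ` R then Some (inv_into R b x) else None)" for x
  have ca: "c (a r) = Some r" and gb: "g (b r) = Some r" if "r \<in> R" for r
    using that inv_into_f_f[OF a(1)] inv_into_f_f[OF b(1)] by (simp_all add: c_def g_def)
  have cS: "{x\<in>X. c x = Some r} = {a r}" and gS: "{x\<in>X. g x = Some r} = {b r}" if "r \<in> R" for r
    using that a b by (auto simp: c_def g_def split: if_splits dest: inj_onD)
  have cN: "{x\<in>X. c x = None} = X - a ` R" and gN: "{x\<in>X. g x = None} = X - b ` R"
    by (auto simp: c_def g_def)
  have cardN: "card (X - a ` R) = card X - card R" "card (X - b ` R) = card X - card R"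
    using assms finR by (simp_all add: card_Diff_subset card_image)
  have "\<tau> permutes X \<Longrightarrow> (\<forall>r\<in>R. \<tau> (a r) = b r) \<longleftrightarrow> (\<forall>x\<in>X. g (\<tau> x) = c x)" for \<tau>
  proof safe
    fix x assume *: "\<tau> permutes X" "\<forall>r\<in>R. \<tau> (a r) = b r" "x \<in> X"
    show "g (\<tau> x) = c x"
    proof (cases "x \<in> a ` R")
      case True
      then show ?thesis using * ca gb by auto
    next
      case False
      \<comment> \<open>All values \<open>b r\<close> are already taken by the points
        \<open>a r\<close>, so injectivity keeps every other point away from them.\<close>
      have "\<tau> x \<notin> b ` R"
      proof
        assume "\<tau> x \<in> b ` R"
        then obtain r where "r \<in> R" "\<tau> x = \<tau> (a r)" using * by auto
        with False show False using permutes_inj[OF *(1)] by (auto dest: injD)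
      qed
      then show ?thesis using False by (simp add: c_def g_def)
    qed
  next
    fix r assume *: "\<forall>x\<in>X. g (\<tau> x) = c x" "r \<in> R"
    then have "g (\<tau> (a r)) = Some r" using ca a by auto
    then have "\<tau> (a r) \<in> b ` R" "inv_into R b (\<tau> (a r)) = r"
      by (auto simp: g_def split: if_splits)
    then show "\<tau> (a r) = b r" using f_inv_into_f by metis
  qed
  then have "{\<tau>. \<tau> permutes X \<and> (\<forall>r\<in>R. \<tau> (a r) = b r)} = {\<tau>. \<tau> permutes X \<and> (\<forall>x\<in>X. g (\<tau> x) = c x)}"
    by blast
  also have "card \<dots> = (\<Prod>j\<in>insert None (Some ` R). fact (card {x\<in>X. c x = j}))"
  proof (rule card_permutes_fibres)
    show "c ` X \<subseteq> insert None (Some ` R)"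
      using a by (auto simp: c_def)
    show "card {x\<in>X. g x = j} = card {x\<in>X. c x = j}" if "j \<in> insert None (Some ` R)" for j
      using that by (auto simp: cS gS cN gN cardN)
  qed (use \<open>finite X\<close> finR in auto)
  also have "\<dots> = fact (card X - card R)"
    using finR by (subst prod.insert) (auto simp: cN cardN prod.reindex cS)
  finally show ?thesis .
qed

lemma card_div_fibre:
  fixes M :: nat
  assumes "i < n"
  shows "card {r\<in>{0..<M * n}. r div M = i} = M"
proof (cases "M = 0")
  case False
  have "{r\<in>{0..<M * n}. r div M = i} = {i * M..<i * M + M}"
  proof (intro equalityI subsetI)
    fix r assume "r \<in> {i * M..<i * M + M}"
    then have "r div M = i" by (intro div_nat_eqI) (auto simp: mult.commute)
    moreover have "i * M + M \<le> M * n"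
      using assms by (metis Suc_leI mult.commute mult_Suc_right mult_le_mono2 add.commute)
    ultimately show "r \<in> {r\<in>{0..<M * n}. r div M = i}"
      using \<open>r \<in> {i * M..<i * M + M}\<close> by auto
  next
    fix r assume "r \<in> {r\<in>{0..<M * n}. r div M = i}"
    then have "r = i * M + r mod M" "r mod M < M"
      using False by (metis (mono_tags, lifting) div_mult_mod_eq mem_Collect_eq) (use False in auto)
    then show "r \<in> {i * M..<i * M + M}" by (metis atLeastLessThan_iff le_add1 nat_add_left_cancel_less)
  qed
  then show ?thesis by simp
qed simp

text \<open>For a permutation \<open>\<sigma>\<close> of \<open>{0..<M * n}\<close>, the function \<open>c\<close> is \<open>r \<mapsto> \<sigma> r div M\<close>, the block column of row \<open>r\<close>.\<close>

definition block_count :: "nat \<Rightarrow> nat \<Rightarrow> (nat \<Rightarrow> nat) \<Rightarrow> nat \<times> nat \<Rightarrow> nat" where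
  "block_count M n c b = card {r\<in>{0..<M * n}. (r div M, c r) = b}"

section \<open>Averaging over families of permutation matrices\<close>

lemma inj_on_mod_div_fibre: "inj_on (\<lambda>r. r mod M) {r. r div M = (i::nat)}"
proof (rule inj_onI)
  fix x y assume "x \<in> {r. r div M = i}" "y \<in> {r. r div M = i}" "x mod M = y mod M"
  then show "x = y" using div_mult_mod_eq[of x M] div_mult_mod_eq[of y M] by simp
qed

lemma perm_matrices_eq:
  "perm_matrices M = (\<lambda>\<sigma>. mat M M (\<lambda>(i, j). if j = \<sigma> i then 1 else 0)) ` {\<sigma>. \<sigma> permutes {0..<M}}"
  by (auto simp: perm_matrices_def)

lemma inj_on_perm_matrix:
  "inj_on (\<lambda>\<sigma>. mat M M (\<lambda>(i, j). if j = \<sigma> i then 1 else (0 :: 'a :: zero_neq_one))) {\<sigma>. \<sigma> permutes {0..<M}}"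
proof (rule inj_onI, rule ext, clarify)
  fix \<sigma> \<tau> x assume \<sigma>: "\<sigma> permutes {0..<M}" and \<tau>: "\<tau> permutes {0..<M}"
    and eq: "mat M M (\<lambda>(i, j). if j = \<sigma> i then 1 else (0 :: 'a)) = mat M M (\<lambda>(i, j). if j = \<tau> i then 1 else 0)"
  show "\<sigma> x = \<tau> x"
  proof (cases "x < M")
    case True
    then have "\<sigma> x < M" using permutes_in_image[OF \<sigma>, of x] by simp
    with True have "(if \<sigma> x = \<sigma> x then 1 else (0 :: 'a)) = (if \<sigma> x = \<tau> x then 1 else 0)"
      using arg_cong[OF eq, of "\<lambda>B. B $$ (x, \<sigma> x)"] by simp
    then show ?thesis by (auto split: if_splits)
  next
    case False
    then show ?thesis using \<sigma> \<tau> by (simp add: permutes_not_in)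
  qed
qed

lemma finite_perm_matrices: "finite (perm_matrices M)"
  by (simp add: perm_matrices_eq finite_permutations)

lemma card_perm_matrices: "card (perm_matrices M :: 'a :: zero_neq_one mat set) = fact M"
  by (simp add: perm_matrices_eq card_image inj_on_perm_matrix card_permutations)

text \<open>For the matrix of \<open>\<tau>\<close> the product is the indicator of
  \<open>\<tau> (a r) = b r\<close> for all \<open>r\<close>, so the sum counts the extensions of a
  partial injection.\<close>

lemma sum_perm_matrices_prod:
  assumes "inj_on a R" "a ` R \<subseteq> {0..<M}" "inj_on b R" "b ` R \<subseteq> {0..<M}"
  shows "(\<Sum>p\<in>perm_matrices M. \<Prod>r\<in>R. p $$ (a r, b r)) = (fact (M - card R) :: 'a :: {comm_semiring_1, semiring_char_0})"
proof -
  have finR: "finite R" by (rule finite_imageD[OF finite_subset[OF assms(2)] assms(1)]) simp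
  have "(\<Sum>p\<in>perm_matrices M. \<Prod>r\<in>R. p $$ (a r, b r)) =
      (\<Sum>\<tau> | \<tau> permutes {0..<M}. \<Prod>r\<in>R. mat M M (\<lambda>(i, j). if j = \<tau> i then 1 else (0 :: 'a)) $$ (a r, b r))"
    unfolding perm_matrices_eq by (subst sum.reindex[OF inj_on_perm_matrix]) (simp add: o_def)
  also have "\<dots> = (\<Sum>\<tau> | \<tau> permutes {0..<M}. if \<forall>r\<in>R. \<tau> (a r) = b r then 1 else 0)"
  proof (rule sum.cong[OF refl])
    fix \<tau> :: "nat \<Rightarrow> nat"
    have "(\<Prod>r\<in>R. mat M M (\<lambda>(i, j). if j = \<tau> i then 1 else (0 :: 'a)) $$ (a r, b r)) =
        (\<Prod>r\<in>R. if \<tau> (a r) = b r then 1 else 0)"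
      using assms by (intro prod.cong) (auto simp: image_subset_iff)
    also have "\<dots> = (if \<forall>r\<in>R. \<tau> (a r) = b r then 1 else 0)"
      using finR by (auto intro!: prod.neutral prod_zero)
    finally show "(\<Prod>r\<in>R. mat M M (\<lambda>(i, j). if j = \<tau> i then 1 else (0 :: 'a)) $$ (a r, b r)) = \<dots>" .
  qed
  also have "\<dots> = of_nat (card {\<tau>. \<tau> permutes {0..<M} \<and> (\<forall>r\<in>R. \<tau> (a r) = b r)})"
    by (simp add: sum.If_cases finite_permutations Int_def)
  also have "\<dots> = fact (M - card R)"
    by (subst card_permutes_extending) (use assms in auto)
  finally show ?thesis .
qed

text \<open>After exchanging the sums, the rows are grouped, for a fixed \<open>\<sigma>\<close>, by
  the block that contains the position \<open>(r, \<sigma> r)\<close>. Each block then contributes a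
  sum over one permutation matrix with some entries prescribed to be 1.\<close>

lemma sum_permanent_lift_all_one:
  assumes M: "M > 0"
  shows "(\<Sum>P\<in>perm_matrix_families n M. permanent (lift_mat M (all_one_mat n) P)) =
    (\<Sum>\<sigma> | \<sigma> permutes {0..<M * n}.
       \<Prod>b\<in>{0..<n} \<times> {0..<n}. fact (M - block_count M n (\<lambda>r. \<sigma> r div M) b))"
proof -
  let ?I = "{0..<n} \<times> {0..<n}" and ?S = "{\<sigma>. \<sigma> permutes {0..<M * n}}"
  let ?F = "\<lambda>\<sigma> b. {r\<in>{0..<M * n}. (r div M, \<sigma> r div M) = b}"
  have lift: "permanent (lift_mat M (all_one_mat n) P) =
      (\<Sum>\<sigma>\<in>?S. \<Prod>b\<in>?I. \<Prod>r\<in>?F \<sigma> b. P b $$ (r mod M, \<sigma> r mod M))"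
    if P: "P \<in> perm_matrix_families n M" for P
  proof -
    have "permanent (lift_mat M (all_one_mat n) P) =
      (\<Sum>\<sigma>\<in>?S. \<Prod>r\<in>{0..<M * n}. lift_mat M (all_one_mat n) P $$ (r, \<sigma> r))"
      by (simp add: permanent_def lift_mat_def all_one_mat_def)
    also have "\<dots> = (\<Sum>\<sigma>\<in>?S. \<Prod>b\<in>?I. \<Prod>r\<in>?F \<sigma> b. P b $$ (r mod M, \<sigma> r mod M))"
    proof (rule sum.cong[OF refl], clarify)
      fix \<sigma> assume \<sigma>: "\<sigma> permutes {0..<M * n}"
      have lt: "r div M < n" "\<sigma> r < M * n" "\<sigma> r div M < n" if "r < M * n" for r
        using that permutes_in_image[OF \<sigma>, of r] by (auto simp: less_mult_imp_div_less mult.commute)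
      have "(\<Prod>r\<in>{0..<M * n}. lift_mat M (all_one_mat n) P $$ (r, \<sigma> r)) =
        (\<Prod>r\<in>{0..<M * n}. P (r div M, \<sigma> r div M) $$ (r mod M, \<sigma> r mod M))"
      proof (rule prod.cong[OF refl])
        fix r assume r: "r \<in> {0..<M * n}"
        have "P (r div M, \<sigma> r div M) \<in> perm_matrices M"
          using P lt[of r] r by (auto simp: perm_matrix_families_def PiE_def)
        then have "dim_row (P (r div M, \<sigma> r div M)) = M" "dim_col (P (r div M, \<sigma> r div M)) = M"
          by (auto simp: perm_matrices_def)
        then show "lift_mat M (all_one_mat n) P $$ (r, \<sigma> r) = P (r div M, \<sigma> r div M) $$ (r mod M, \<sigma> r mod M)"
          using lt[of r] r M by (simp add: lift_mat_def all_one_mat_def)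
      qed
      also have "\<dots> = (\<Prod>b\<in>?I. \<Prod>r\<in>?F \<sigma> b. P (r div M, \<sigma> r div M) $$ (r mod M, \<sigma> r mod M))"
        by (rule prod.group[symmetric]) (use lt in auto)
      also have "\<dots> = (\<Prod>b\<in>?I. \<Prod>r\<in>?F \<sigma> b. P b $$ (r mod M, \<sigma> r mod M))"
        by (intro prod.cong) auto
      finally show "(\<Prod>r\<in>{0..<M * n}. lift_mat M (all_one_mat n) P $$ (r, \<sigma> r)) = \<dots>" .
    qed
    finally show ?thesis .
  qed
  have "(\<Sum>P\<in>perm_matrix_families n M. permanent (lift_mat M (all_one_mat n) P)) =
      (\<Sum>\<sigma>\<in>?S. \<Sum>P\<in>?I \<rightarrow>\<^sub>E perm_matrices M. \<Prod>b\<in>?I. \<Prod>r\<in>?F \<sigma> b. P b $$ (r mod M, \<sigma> r mod M))"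
    by (subst sum.swap) (simp add: lift, simp add: perm_matrix_families_def)
  \<comment> \<open>The blocks of a family are chosen independently, so the sum over families
    factors.\<close>
  also have "\<dots> = (\<Sum>\<sigma>\<in>?S. \<Prod>b\<in>?I. \<Sum>p\<in>perm_matrices M. \<Prod>r\<in>?F \<sigma> b. p $$ (r mod M, \<sigma> r mod M))"
    by (subst prod_sum_PiE) (auto simp: finite_perm_matrices)
  also have "\<dots> = (\<Sum>\<sigma>\<in>?S. \<Prod>b\<in>?I. fact (M - block_count M n (\<lambda>r. \<sigma> r div M) b))"
  proof (intro sum.cong prod.cong refl)
    fix \<sigma> b assume \<sigma>: "\<sigma> \<in> ?S"
    \<comment> \<open>Rows of one block row have distinct residues mod \<open>M\<close>; the same
      holds for their images, which lie in one block column.\<close>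
    have "inj_on (\<lambda>r. r mod M) (?F \<sigma> b)"
      by (rule inj_on_subset[OF inj_on_mod_div_fibre[of M "fst b"]]) auto
    moreover have "inj_on (\<lambda>r. \<sigma> r mod M) (?F \<sigma> b)"
    proof -
      have "inj_on \<sigma> (?F \<sigma> b)" using \<sigma> permutes_inj_on by blast
      moreover have "inj_on (\<lambda>r. r mod M) (\<sigma> ` ?F \<sigma> b)"
        by (rule inj_on_subset[OF inj_on_mod_div_fibre[of M "snd b"]]) auto
      ultimately show ?thesis using comp_inj_on[of \<sigma> _ "\<lambda>r. r mod M"] by (simp add: o_def)
    qed
    ultimately show "(\<Sum>p\<in>perm_matrices M. \<Prod>r\<in>?F \<sigma> b. p $$ (r mod M, \<sigma> r mod M)) =
        (fact (M - block_count M n (\<lambda>r. \<sigma> r div M) b) :: real)"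
      using M unfolding block_count_def by (intro sum_perm_matrices_prod) auto
  qed
  finally show ?thesis .
qed

lemma card_perm_matrix_families:
  "card (perm_matrix_families n M :: (nat \<times> nat \<Rightarrow> 'a :: zero_neq_one mat) set) = fact M ^ (n * n)"
  by (simp add: perm_matrix_families_def card_PiE card_perm_matrices)

section \<open>Permutations with a prescribed matrix of block counts\<close>

lemma card_Collect_permutes:
  assumes "\<sigma> permutes X"
  shows "card {x\<in>X. P (\<sigma> x)} = card {x\<in>X. P x}"
proof (rule bij_betw_same_card)
  show "bij_betw \<sigma> {x\<in>X. P (\<sigma> x)} {x\<in>X. P x}"
    using permutes_in_image[OF assms] permutes_inverses[OF assms]
      permutes_in_image[OF permutes_inv[OF assms]]
    by (intro bij_betwI[where g = "inv_into UNIV \<sigma>"]) auto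
qed

lemma card_eq_sum_fibres:
  assumes "finite T" "finite C" "h ` T \<subseteq> C"
  shows "card T = (\<Sum>c\<in>C. card {x\<in>T. h x = c})"
  using sum.group[OF assms, of "\<lambda>_. 1 :: nat"] by simp

lemma card_permutes_block_function:
  assumes "c ` {0..<M * n} \<subseteq> {0..<n}" and "\<And>j. j < n \<Longrightarrow> card {r\<in>{0..<M * n}. c r = j} = M"
  shows "card {\<sigma>. \<sigma> permutes {0..<M * n} \<and> (\<forall>r\<in>{0..<M * n}. \<sigma> r div M = c r)} = fact M ^ n"
proof -
  have "card {\<sigma>. \<sigma> permutes {0..<M * n} \<and> (\<forall>r\<in>{0..<M * n}. \<sigma> r div M = c r)}
      = (\<Prod>j\<in>{0..<n}. fact (card {r\<in>{0..<M * n}. c r = j}))"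
    by (rule card_permutes_fibres) (use assms card_div_fibre[of _ n M] in auto)
  then show ?thesis using assms(2) by simp
qed

lemma block_count_row_sum:
  assumes "c ` {0..<M * n} \<subseteq> {0..<n}" "i < n"
  shows "(\<Sum>j\<in>{0..<n}. block_count M n c (i, j)) = M"
proof -
  have "card {r\<in>{0..<M * n}. r div M = i} = card (\<Union>j\<in>{0..<n}. {r\<in>{0..<M * n}. (r div M, c r) = (i, j)})"
    using assms by (intro arg_cong[of _ _ card]) (auto simp: image_subset_iff)
  also have "\<dots> = (\<Sum>j\<in>{0..<n}. block_count M n c (i, j))"
    unfolding block_count_def by (rule card_UN_disjoint) auto
  finally show ?thesis using card_div_fibre[OF assms(2), of M] by simp
qed

lemma block_count_col_sum:
  "(\<Sum>i\<in>{0..<n}. block_count M n c (i, j)) = card {r\<in>{0..<M * n}. c r = j}"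
proof -
  have "card {r\<in>{0..<M * n}. c r = j} = card (\<Union>i\<in>{0..<n}. {r\<in>{0..<M * n}. (r div M, c r) = (i, j)})"
    by (intro arg_cong[of _ _ card]) (auto simp: less_mult_imp_div_less mult.commute)
  also have "\<dots> = (\<Sum>i\<in>{0..<n}. block_count M n c (i, j))"
    unfolding block_count_def by (rule card_UN_disjoint) auto
  finally show ?thesis by simp
qed

text \<open>The permutations \<open>\<rho>\<close> preserving the block rows act transitively, by \<open>c \<mapsto> c \<circ> \<rho>\<close>, on the column
  functions with the given counts, and each such function comes from \<open>fact M ^ n\<close> permutations.\<close>

lemma card_permutes_block_count:
  fixes c0 :: "nat \<Rightarrow> nat"
  assumes c0: "c0 ` {0..<M * n} \<subseteq> {0..<n}" "\<And>j. j < n \<Longrightarrow> card {r\<in>{0..<M * n}. c0 r = j} = M"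
  shows "card {\<sigma>. \<sigma> permutes {0..<M * n} \<and>
      (\<forall>b\<in>{0..<n} \<times> {0..<n}. block_count M n (\<lambda>r. \<sigma> r div M) b = block_count M n c0 b)} *
    (\<Prod>b\<in>{0..<n} \<times> {0..<n}. fact (block_count M n c0 b)) = fact M ^ (2 * n)"
    (is "card ?T * ?P = _")
proof -
  let ?X = "{0..<M * n}" and ?I = "{0..<n} \<times> {0..<n}" and ?bc = "block_count M n"
  define C where "C = {c \<in> ?X \<rightarrow>\<^sub>E {0..<n}. \<forall>b\<in>?I. ?bc c b = ?bc c0 b}"
  define R where "R = {\<rho>. \<rho> permutes ?X \<and> (\<forall>r\<in>?X. \<rho> r div M = r div M)}"
  have finC: "finite C" unfolding C_def by (simp add: finite_PiE)
  have finR: "finite R" and finT: "finite ?T"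
    unfolding R_def by (rule finite_subset[OF _ finite_permutations[of ?X]]; auto)+
  have div_lt: "r div M < n" if "r \<in> ?X" for r
    using that by (simp add: less_mult_imp_div_less mult.commute)
  have bc_cong: "?bc c b = ?bc c' b" if "\<And>r. r \<in> ?X \<Longrightarrow> c r = c' r" for c c' b
    unfolding block_count_def using that by (intro arg_cong[of _ _ card]) auto
  have cardR: "card R = fact M ^ n"
    unfolding R_def by (rule card_permutes_block_function) (use div_lt card_div_fibre in auto)
  \<comment> \<open>First count: \<open>?T\<close> is fibred over \<open>C\<close> by the block
    column function of \<open>\<sigma>\<close>, and every fibre has \<open>fact M ^ n\<close>
    elements.\<close>
  have "card ?T = (\<Sum>c\<in>C. card {\<sigma> \<in> ?T. restrict (\<lambda>r. \<sigma> r div M) ?X = c})"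
  proof -
    have "restrict (\<lambda>r. \<sigma> r div M) ?X \<in> C" if "\<sigma> \<in> ?T" for \<sigma>
    proof -
      have "\<sigma> permutes ?X" using that by simp
      then have "\<sigma> r div M < n" if "r \<in> ?X" for r
        using that div_lt permutes_in_image[of \<sigma> ?X] by blast
      moreover have "?bc (restrict (\<lambda>r. \<sigma> r div M) ?X) b = ?bc (\<lambda>r. \<sigma> r div M) b" for b
        by (rule bc_cong) auto
      ultimately show ?thesis using \<open>\<sigma> \<in> ?T\<close> by (auto simp: C_def)
    qed
    then show ?thesis
      by (intro card_eq_sum_fibres finT finC) blast
  qed
  also have "\<dots> = (\<Sum>c\<in>C. fact M ^ n)"
  proof (rule sum.cong[OF refl])
    fix c assume c: "c \<in> C"
    have "{\<sigma> \<in> ?T. restrict (\<lambda>r. \<sigma> r div M) ?X = c} =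
        {\<sigma>. \<sigma> permutes ?X \<and> (\<forall>r\<in>?X. \<sigma> r div M = c r)}"
    proof (intro equalityI subsetI)
      fix \<sigma> assume \<sigma>: "\<sigma> \<in> {\<sigma>. \<sigma> permutes ?X \<and> (\<forall>r\<in>?X. \<sigma> r div M = c r)}"
      then have "?bc (\<lambda>r. \<sigma> r div M) b = ?bc c b" for b by (intro bc_cong) auto
      then have "\<sigma> \<in> ?T" using \<sigma> c by (simp add: C_def)
      moreover have "restrict (\<lambda>r. \<sigma> r div M) ?X = c"
        using \<sigma> c by (auto simp: C_def PiE_def extensional_def fun_eq_iff)
      ultimately show "\<sigma> \<in> {\<sigma> \<in> ?T. restrict (\<lambda>r. \<sigma> r div M) ?X = c}" by blast
    qed auto
    also have "card \<dots> = fact M ^ n"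
    proof (rule card_permutes_block_function)
      show "c ` ?X \<subseteq> {0..<n}" using c by (auto simp: C_def PiE_def)
      show "card {r\<in>?X. c r = j} = M" if "j < n" for j
      proof -
        \<comment> \<open>Equal counts have equal column sums, so \<open>c\<close> inherits from
          \<open>c0\<close> that each value is taken \<open>M\<close> times.\<close>
        have "(\<Sum>i\<in>{0..<n}. ?bc c (i, j)) = (\<Sum>i\<in>{0..<n}. ?bc c0 (i, j))"
          using c that by (intro sum.cong) (auto simp: C_def)
        then show ?thesis unfolding block_count_col_sum c0(2)[OF that] .
      qed
    qed
    finally show "card {\<sigma> \<in> ?T. restrict (\<lambda>r. \<sigma> r div M) ?X = c} = fact M ^ n" .
  qed
  finally have cardT: "card ?T = card C * fact M ^ n" by simp
  \<comment> \<open>Second count, which yields \<open>card C\<close>: the group \<open>R\<close> of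
    known order is fibred over \<open>C\<close> by
    \<open>\<rho> \<mapsto> c0 \<circ> \<rho>\<close>. A fibre consists of the permutations matching
    the pairs (block row, column label) of \<open>c0\<close> and \<open>c\<close>, so it has
    \<open>?P\<close> elements.\<close>
  have "card R = (\<Sum>c\<in>C. card {\<rho> \<in> R. restrict (c0 \<circ> \<rho>) ?X = c})"
  proof -
    have "restrict (c0 \<circ> \<rho>) ?X \<in> C" if "\<rho> \<in> R" for \<rho>
    proof -
      have \<rho>: "\<rho> permutes ?X" using that by (simp add: R_def)
      have "?bc (restrict (c0 \<circ> \<rho>) ?X) b = ?bc c0 b" for b
      proof -
        have "?bc (restrict (c0 \<circ> \<rho>) ?X) b = card {r\<in>?X. (\<rho> r div M, c0 (\<rho> r)) = b}"
          using that unfolding block_count_def by (intro arg_cong[of _ _ card]) (auto simp: R_def)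
        then show ?thesis
          using card_Collect_permutes[OF \<rho>, of "\<lambda>r. (r div M, c0 r) = b"] by (simp add: block_count_def)
      qed
      moreover have "c0 (\<rho> r) < n" if "r \<in> ?X" for r
        using that c0(1) permutes_in_image[OF \<rho>] by (auto simp: image_subset_iff)
      ultimately show ?thesis by (auto simp: C_def)
    qed
    then show ?thesis
      by (intro card_eq_sum_fibres finR finC) blast
  qed
  also have "\<dots> = (\<Sum>c\<in>C. ?P)"
  proof (rule sum.cong[OF refl])
    fix c assume c: "c \<in> C"
    have eq: "{\<rho> \<in> R. restrict (c0 \<circ> \<rho>) ?X = c} =
        {\<rho>. \<rho> permutes ?X \<and> (\<forall>r\<in>?X. (\<lambda>r. (r div M, c0 r)) (\<rho> r) = (r div M, c r))}"
      using c by (auto simp: R_def C_def PiE_def extensional_def fun_eq_iff)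
    have "card {\<rho>. \<rho> permutes ?X \<and> (\<forall>r\<in>?X. (\<lambda>r. (r div M, c0 r)) (\<rho> r) = (r div M, c r))}
        = (\<Prod>b\<in>?I. fact (card {r\<in>?X. (r div M, c r) = b}))"
    proof (rule card_permutes_fibres)
      show "(\<lambda>r. (r div M, c r)) ` ?X \<subseteq> ?I" using c div_lt by (auto simp: C_def PiE_def)
      show "card {x \<in> ?X. (x div M, c0 x) = j} = card {x \<in> ?X. (x div M, c x) = j}" if "j \<in> ?I" for j
      proof -
        have "?bc c j = ?bc c0 j" using c that unfolding C_def by blast
        then show ?thesis by (simp add: block_count_def)
      qed
    qed auto
    also have "\<dots> = ?P"
      using c unfolding block_count_def[symmetric] by (intro prod.cong) (auto simp: C_def)
    finally show "card {\<rho> \<in> R. restrict (c0 \<circ> \<rho>) ?X = c} = ?P"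
      unfolding eq .
  qed
  finally have "card C * ?P = fact M ^ n" using cardR by simp
  then show ?thesis unfolding cardT mult_2 power_add by (metis mult.assoc mult.commute)
qed

section \<open>Smoothing bound for the weight of one block row\<close>

text \<open>Moving a unit between two entries that differ by at least 2 lowers the sum of squares,
  which is the induction measure. Once no such pair is left, all entries are \<open>v\<close> or
  \<open>v + 1\<close> with \<open>v = M div card A\<close>, and rounding each \<open>v + 1\<close>
  down to \<open>v\<close> can only enlarge the product.\<close>

lemma prod_fact_quotient_le_balanced:
  fixes k :: "'a \<Rightarrow> nat" and M :: nat
  assumes "finite A" "card A \<ge> 2" "M > 0" "(\<Sum>a\<in>A. k a) = M"
  shows "(\<Prod>a\<in>A. fact (M - k a) / fact (k a)) \<le>
    (fact (M - M div card A) / fact (M div card A) :: real) ^ card A"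
  using assms(4)
proof (induction "\<Sum>a\<in>A. (k a)\<^sup>2" arbitrary: k rule: less_induct)
  case less
  define f :: "nat \<Rightarrow> real" where "f j = fact (M - j) / fact j" for j
  have fpos: "f j > 0" for j by (simp add: f_def)
  have f_Suc: "f j = f (Suc j) * (real (M - j) * real (Suc j))" if "j < M" for j
  proof -
    have "M - j = Suc (M - Suc j)" using that by simp
    then have "fact (M - j) = real (M - j) * fact (M - Suc j)" by (metis fact_Suc of_nat_fact of_nat_mult)
    then show ?thesis by (simp add: f_def del: of_nat_Suc)
  qed
  show ?case
  proof (cases "\<exists>a\<in>A. \<exists>b\<in>A. k b + 2 \<le> k a")
    case True
    then obtain a b where ab: "a \<in> A" "b \<in> A" "k b + 2 \<le> k a" by auto
    define B where "B = A - {a, b}"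
    have A: "A = insert a (insert b B)" "a \<notin> insert b B" "b \<notin> B" "finite B"
      using ab assms(1) by (auto simp: B_def)
    define k' where "k' = k(a := k a - 1, b := k b + 1)"
    have k': "k' a = k a - 1" "k' b = k b + 1" "\<And>x. x \<in> B \<Longrightarrow> k' x = k x"
      using A ab(3) by (auto simp: k'_def)
    obtain u v where uv: "k a = Suc u" "k b = v" "v < u" using ab(3) by (cases "k a") auto
    have le: "Suc u + v \<le> M"
      using less.prems A uv by (simp add: add.assoc[symmetric])
    have sumB: "(\<Sum>x\<in>B. k' x) = (\<Sum>x\<in>B. k x)" "(\<Sum>x\<in>B. (k' x)\<^sup>2) = (\<Sum>x\<in>B. (k x)\<^sup>2)"
      "(\<Prod>x\<in>B. f (k' x)) = (\<Prod>x\<in>B. f (k x))"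
      using k'(3) by simp_all
    have sum': "(\<Sum>x\<in>A. k' x) = M"
      using less.prems A uv k'(1,2) sumB(1) by simp
    have "(Suc v)\<^sup>2 + u\<^sup>2 < (Suc u)\<^sup>2 + v\<^sup>2"
      using uv(3) by (simp add: power2_eq_square)
    then have "(\<Sum>x\<in>A. (k' x)\<^sup>2) < (\<Sum>x\<in>A. (k x)\<^sup>2)"
      using A uv k'(1,2) sumB(2) by simp
    from less.hyps[OF this sum']
    have IH: "(\<Prod>x\<in>A. f (k' x)) \<le> (fact (M - M div card A) / fact (M div card A)) ^ card A"
      by (simp add: f_def)
    have "f (Suc u) * f v \<le> f u * f (Suc v)"
    proof -
      \<comment> \<open>With \<open>M = Suc u + v + w\<close> the two sides differ by
        \<open>w * (u - v)\<close>. That such a \<open>w\<close> exists uses that the two entries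
        together are at most \<open>M\<close>.\<close>
      have "(M - v) * Suc v \<le> (M - u) * Suc u"
      proof -
        obtain w where M: "M = Suc u + v + w" using le less_eqE by blast
        obtain t where u: "u = v + Suc t" using uv(3) less_iff_Suc_add by auto
        have "M - v = Suc u + w" "M - u = Suc (v + w)" using M by auto
        then show ?thesis using u by (simp add: algebra_simps)
      qed
      then have "real (M - v) * real (Suc v) \<le> real (M - u) * real (Suc u)"
        unfolding of_nat_mult[symmetric] of_nat_le_iff .
      then have "f (Suc u) * f (Suc v) * (real (M - v) * real (Suc v)) \<le>
          f (Suc u) * f (Suc v) * (real (M - u) * real (Suc u))"
        using fpos by (intro mult_left_mono) (auto intro: less_imp_le)
      then show ?thesis using f_Suc[of u] f_Suc[of v] le uv(3) by (simp add: mult_ac)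
    qed
    moreover have "(\<Prod>x\<in>B. f (k x)) \<ge> 0" using fpos by (intro prod_nonneg) (auto intro: less_imp_le)
    ultimately have "f (Suc u) * f v * (\<Prod>x\<in>B. f (k x)) \<le> f u * f (Suc v) * (\<Prod>x\<in>B. f (k x))"
      by (rule mult_right_mono)
    then have "(\<Prod>x\<in>A. f (k x)) \<le> (\<Prod>x\<in>A. f (k' x))"
      using A uv k'(1,2) sumB(3) by (simp add: mult_ac)
    with IH show ?thesis by (simp add: f_def)
  next
    case False
    define v where "v = Min (k ` A)"
    have ne: "A \<noteq> {}" using assms(2) by auto
    have "v \<in> k ` A" unfolding v_def using assms(1) ne by (intro Min_in) auto
    then obtain b where b: "b \<in> A" "k b = v" by auto
    have k: "k a = v \<or> k a = Suc v" if "a \<in> A" for a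
    proof -
      have "v \<le> k a" unfolding v_def using that assms(1) by simp
      moreover have "\<not> v + 2 \<le> k a" using False that b by auto
      ultimately show ?thesis by auto
    qed
    have "(\<Sum>a\<in>A. v) \<le> (\<Sum>a\<in>A. k a)" using k by (intro sum_mono) force
    moreover have "(\<Sum>a\<in>A. k a) < (\<Sum>a\<in>A. Suc v)"
      using assms(1) b k by (intro sum_strict_mono_ex1) (auto, force)
    ultimately have v: "M div card A = v"
      using less.prems by (intro div_nat_eqI) (auto simp: mult.commute)
    \<comment> \<open>With at least two entries \<open>v\<close> stays below \<open>M\<close>, so
      the quotient \<open>(M - v) * (v + 1)\<close> of \<open>f v\<close> by
      \<open>f (v + 1)\<close> is at least 1.\<close>
    have "v < M" unfolding v[symmetric] using assms by (intro div_less_dividend) auto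
    then have "f (Suc v) \<le> f v"
    proof -
      have "1 * 1 \<le> real (M - v) * real (Suc v)" using \<open>v < M\<close> by (intro mult_mono) auto
      then have "1 \<le> real (M - v) * real (Suc v)" by (simp only: mult_1)
      then have "f (Suc v) * 1 \<le> f (Suc v) * (real (M - v) * real (Suc v))"
        by (rule mult_left_mono[OF _ less_imp_le[OF fpos]])
      then show ?thesis using f_Suc[OF \<open>v < M\<close>] by simp
    qed
    then have "(\<Prod>a\<in>A. f (k a)) \<le> (\<Prod>a\<in>A. f v)"
      using k fpos by (intro prod_mono) (auto intro: less_imp_le, force)
    then show ?thesis unfolding v by (simp add: f_def)
  qed
qed

section \<open>Two-sided bounds for the Bethe permanent of degree \<open>M\<close>\<close>

text \<open>This provides the witness with perfectly balanced counts:
  \<open>r mod (q * n) div q\<close> cuts each block row into \<open>n\<close> runs of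
  \<open>q\<close> consecutive rows and sends run \<open>j\<close> to block column
  \<open>j\<close>.\<close>

lemma card_mod_div_fibre:
  fixes q n :: nat
  assumes "i < n" "j < n"
  shows "card {r\<in>{0..<q * n * n}. r div (q * n) = i \<and> r mod (q * n) div q = j} = q"
proof (cases "q = 0")
  case False
  have "{r\<in>{0..<q * n * n}. r div (q * n) = i \<and> r mod (q * n) div q = j} =
      (\<lambda>s. i * (q * n) + (j * q + s)) ` {0..<q}" (is "?L = ?R")
  proof (intro equalityI subsetI)
    fix r assume "r \<in> ?L"
    then have "r = i * (q * n) + (j * q + r mod (q * n) mod q)"
      using div_mult_mod_eq[of r "q * n"] div_mult_mod_eq[of "r mod (q * n)" q] by simp
    then show "r \<in> ?R" using False by (intro image_eqI[of _ _ "r mod (q * n) mod q"]) auto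
  next
    fix r assume "r \<in> ?R"
    then obtain s where s: "s < q" "r = i * (q * n) + (j * q + s)" by auto
    have "j * q + s < Suc j * q" using s by simp
    also have "\<dots> \<le> n * q" using assms by (intro mult_le_mono1) simp
    finally have lt: "j * q + s < q * n" by (simp add: mult.commute)
    have "r < Suc i * (q * n)" using lt s by simp
    also have "\<dots> \<le> n * (q * n)" using assms by (intro mult_le_mono1) simp
    finally have "r < q * n * n" by (simp add: mult_ac)
    moreover have "(i * m + t) div m = i \<and> (i * m + t) mod m = t" if "t < m" for t m :: nat
      using that by simp
    then have "r div (q * n) = i" "r mod (q * n) = j * q + s"
      using lt s(2) by blast+
    moreover have "(j * q + s) div q = j" using s(1) by simp
    ultimately show "r \<in> ?L" by simp
  qed
  then show ?thesis by (simp add: card_image inj_on_def)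
qed simp

lemma bethe_perm_deg_all_one:
  assumes "M > 0"
  shows "bethe_perm_deg M (all_one_mat n) = root M
    ((\<Sum>\<sigma> | \<sigma> permutes {0..<M * n}.
       \<Prod>b\<in>{0..<n} \<times> {0..<n}. fact (M - block_count M n (\<lambda>r. \<sigma> r div M) b)) / fact M ^ (n * n))"
  unfolding bethe_perm_deg_def using sum_permanent_lift_all_one[OF assms, of n]
  by (simp add: all_one_mat_def card_perm_matrix_families)

text \<open>The averaged contribution of the class with all counts equal to \<open>M div n\<close>:
  its size times its weight. If \<open>n \<ge> 2\<close> does not divide \<open>M\<close>, no
  permutation has these counts and the number is only an upper bound for each class.\<close>

definition balanced_weight :: "nat \<Rightarrow> nat \<Rightarrow> real" where
  "balanced_weight n M = fact M ^ (2 * n) *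
     (fact (M - M div n) / fact (M div n)) ^ (n * n) / fact M ^ (n * n)"

text \<open>The weight is constant on the class, whose size is given by
  \<open>card_permutes_block_count\<close>.\<close>

lemma sum_block_count_eq:
  fixes c0 :: "nat \<Rightarrow> nat"
  assumes "c0 ` {0..<M * n} \<subseteq> {0..<n}" "\<And>j. j < n \<Longrightarrow> card {r\<in>{0..<M * n}. c0 r = j} = M"
  shows "(\<Sum>\<sigma> | \<sigma> permutes {0..<M * n} \<and>
      (\<forall>b\<in>{0..<n} \<times> {0..<n}. block_count M n (\<lambda>r. \<sigma> r div M) b = block_count M n c0 b).
       \<Prod>b\<in>{0..<n} \<times> {0..<n}. fact (M - block_count M n (\<lambda>r. \<sigma> r div M) b)) =
    (fact M ^ (2 * n) * (\<Prod>b\<in>{0..<n} \<times> {0..<n}. fact (M - block_count M n c0 b) / fact (block_count M n c0 b)) :: real)"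
    (is "sum ?f ?T = _")
proof -
  let ?I = "{0..<n} \<times> {0..<n}"
  have "sum ?f ?T = (\<Sum>\<sigma>\<in>?T. \<Prod>b\<in>?I. fact (M - block_count M n c0 b))"
    by (intro sum.cong prod.cong refl) auto
  then have "sum ?f ?T = real (card ?T) * (\<Prod>b\<in>?I. fact (M - block_count M n c0 b))"
    by (simp only: sum_constant)
  moreover have "real (card ?T * (\<Prod>b\<in>?I. fact (block_count M n c0 b))) = real (fact M ^ (2 * n))"
    by (rule arg_cong[OF card_permutes_block_count[OF assms]])
  then have "real (card ?T) = fact M ^ (2 * n) / (\<Prod>b\<in>?I. fact (block_count M n c0 b))"
    by (simp add: field_simps)
  ultimately show ?thesis by (simp add: prod_dividef)
qed

text \<open>All terms are nonnegative, so it suffices to keep the permutations with all counts equal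
  to \<open>q\<close>. Degrees divisible by \<open>n\<close> are enough to bound a limit superior
  from below.\<close>

lemma balanced_weight_le_bethe_perm_deg:
  assumes "n > 0" "q > 0"
  shows "root (q * n) (balanced_weight n (q * n)) \<le> bethe_perm_deg (q * n) (all_one_mat n)"
proof -
  let ?M = "q * n" and ?I = "{0..<n} \<times> {0..<n}"
  define c0 where "c0 r = r mod ?M div q" for r
  have bc: "block_count ?M n c0 b = q" if "b \<in> ?I" for b
    using that card_mod_div_fibre[of "fst b" n "snd b" q] by (auto simp: block_count_def c0_def)
  have c0: "c0 r < n" for r
    unfolding c0_def by (intro less_mult_imp_div_less) (use assms in \<open>simp add: mult.commute\<close>)
  have fib: "card {r\<in>{0..<?M * n}. c0 r = j} = ?M" if "j < n" for j
    unfolding block_count_col_sum[symmetric] using bc that by simp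
  let ?f = "\<lambda>\<sigma>. \<Prod>b\<in>?I. fact (?M - block_count ?M n (\<lambda>r. \<sigma> r div ?M) b) :: real"
  let ?T = "{\<sigma>. \<sigma> permutes {0..<?M * n} \<and>
      (\<forall>b\<in>?I. block_count ?M n (\<lambda>r. \<sigma> r div ?M) b = block_count ?M n c0 b)}"
  have "fact ?M ^ (2 * n) * (fact (?M - q) / fact q) ^ (n * n) = sum ?f ?T"
    by (subst sum_block_count_eq) (use c0 fib bc in auto)
  also have "\<dots> \<le> (\<Sum>\<sigma> | \<sigma> permutes {0..<?M * n}. ?f \<sigma>)"
    by (rule sum_mono2) (auto simp: finite_permutations intro!: prod_nonneg)
  finally show ?thesis
    using assms unfolding balanced_weight_def
    by (subst bethe_perm_deg_all_one) (auto intro!: real_root_le_mono divide_right_mono)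
qed

text \<open>The permutations are grouped by count matrix. Every entry of such a matrix is at most
  \<open>M\<close>, which bounds the number of groups by a power of \<open>M + 1\<close>; each group
  contributes at most the balanced weight.\<close>

lemma bethe_perm_deg_le_balanced_weight:
  assumes "n \<ge> 2" "M > 0"
  shows "bethe_perm_deg M (all_one_mat n) \<le> root M (real ((M + 1) ^ (n * n)) * balanced_weight n M)"
proof -
  let ?I = "{0..<n} \<times> {0..<n}" and ?S = "{\<sigma>. \<sigma> permutes {0..<M * n}}"
  let ?bc = "\<lambda>\<sigma>. block_count M n (\<lambda>r. \<sigma> r div M)"
  let ?f = "\<lambda>\<sigma>. \<Prod>b\<in>?I. fact (M - ?bc \<sigma> b) :: real"
  let ?w = "fact M ^ (2 * n) * (fact (M - M div n) / fact (M div n)) ^ (n * n) :: real"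
  define Ty where "Ty = (\<lambda>\<sigma>. restrict (?bc \<sigma>) ?I) ` ?S"
  have blk: "(\<lambda>r. \<sigma> r div M) ` {0..<M * n} \<subseteq> {0..<n}" if "\<sigma> permutes {0..<M * n}" for \<sigma>
  proof (rule image_subsetI)
    fix r assume "r \<in> {0..<M * n}"
    then have "\<sigma> r \<in> {0..<M * n}" using permutes_in_image[OF that, of r] by blast
    then show "\<sigma> r div M \<in> {0..<n}"
      using less_mult_imp_div_less[of "\<sigma> r" n M] by (simp add: mult.commute)
  qed
  have bc_le: "?bc \<sigma> b \<le> M" if \<sigma>: "\<sigma> permutes {0..<M * n}" and bI: "b \<in> ?I" for \<sigma> b
  proof -
    obtain i j where b: "b = (i, j)" "i < n" "j < n" using bI by auto
    have "?bc \<sigma> (i, j) \<le> (\<Sum>j\<in>{0..<n}. ?bc \<sigma> (i, j))"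
      using b by (intro member_le_sum) auto
    also have "\<dots> = M" by (rule block_count_row_sum[OF blk[OF \<sigma>] b(2)])
    finally show ?thesis unfolding b(1) .
  qed
  have Ty_sub: "Ty \<subseteq> ?I \<rightarrow>\<^sub>E {0..M}"
  proof
    fix K assume "K \<in> Ty"
    then obtain \<sigma> where "\<sigma> permutes {0..<M * n}" "K = restrict (?bc \<sigma>) ?I"
      unfolding Ty_def by blast
    then show "K \<in> ?I \<rightarrow>\<^sub>E {0..M}"
      using bc_le[of \<sigma>] by (simp only: restrict_PiE_iff atLeastAtMost_iff le0 simp_thms ball_simps) blast
  qed
  have finTy: "finite Ty" by (rule finite_subset[OF Ty_sub]) (simp add: finite_PiE)
  have "card Ty \<le> card (?I \<rightarrow>\<^sub>E {0..M})" by (rule card_mono[OF _ Ty_sub]) (simp add: finite_PiE)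
  then have cardTy: "card Ty \<le> (M + 1) ^ (n * n)" by (simp add: card_funcsetE)
  have "(\<Sum>\<sigma>\<in>?S. ?f \<sigma>) = (\<Sum>K\<in>Ty. \<Sum>\<sigma>\<in>{\<sigma>\<in>?S. restrict (?bc \<sigma>) ?I = K}. ?f \<sigma>)"
    by (rule sum.group[symmetric]) (auto simp: finTy finite_permutations Ty_def)
  also have "\<dots> \<le> (\<Sum>K\<in>Ty. ?w)"
  proof (rule sum_mono)
    fix K assume "K \<in> Ty"
    then obtain \<sigma>0 where \<sigma>0: "\<sigma>0 permutes {0..<M * n}" and K: "K = restrict (?bc \<sigma>0) ?I"
      by (auto simp: Ty_def)
    have "card {r\<in>{0..<M * n}. \<sigma>0 r div M = j} = M" if "j < n" for j
      using card_Collect_permutes[OF \<sigma>0, of "\<lambda>r. r div M = j"] card_div_fibre[OF that] by simp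
    note eq = sum_block_count_eq[OF blk[OF \<sigma>0] this]
    have "{\<sigma>\<in>?S. restrict (?bc \<sigma>) ?I = K} = {\<sigma>. \<sigma> permutes {0..<M * n} \<and> (\<forall>b\<in>?I. ?bc \<sigma> b = ?bc \<sigma>0 b)}"
      unfolding K by (auto simp: fun_eq_iff restrict_def)
    then have sum_eq: "(\<Sum>\<sigma>\<in>{\<sigma>\<in>?S. restrict (?bc \<sigma>) ?I = K}. ?f \<sigma>) =
        fact M ^ (2 * n) * (\<Prod>b\<in>?I. fact (M - ?bc \<sigma>0 b) / fact (?bc \<sigma>0 b))"
      using eq by simp
    have "(\<Prod>b\<in>?I. fact (M - ?bc \<sigma>0 b) / fact (?bc \<sigma>0 b) :: real) =
        (\<Prod>i\<in>{0..<n}. \<Prod>j\<in>{0..<n}. fact (M - ?bc \<sigma>0 (i, j)) / fact (?bc \<sigma>0 (i, j)))"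
      by (simp add: prod.cartesian_product case_prod_beta)
    \<comment> \<open>The block rows are bounded one at a time, using that the counts in each row
      add up to \<open>M\<close>.\<close>
    also have "\<dots> \<le> (\<Prod>i\<in>{0..<n}. (fact (M - M div n) / fact (M div n)) ^ n)"
    proof (intro prod_mono conjI)
      fix i assume "i \<in> {0..<n}"
      then have "(\<Sum>j\<in>{0..<n}. ?bc \<sigma>0 (i, j)) = M"
        by (intro block_count_row_sum blk \<sigma>0) simp
      then have "(\<Prod>j\<in>{0..<n}. fact (M - ?bc \<sigma>0 (i, j)) / fact (?bc \<sigma>0 (i, j))) \<le>
          (fact (M - M div card {0..<n}) / fact (M div card {0..<n}) :: real) ^ card {0..<n}"
        by (rule prod_fact_quotient_le_balanced[rotated 3]) (use assms in simp_all)
      then show "(\<Prod>j\<in>{0..<n}. fact (M - ?bc \<sigma>0 (i, j)) / fact (?bc \<sigma>0 (i, j))) \<le>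
          (fact (M - M div n) / fact (M div n) :: real) ^ n"
        by (simp only: card_atLeastLessThan diff_zero)
    qed (auto intro!: prod_nonneg)
    also have "\<dots> = (fact (M - M div n) / fact (M div n)) ^ (n * n)"
      by (simp add: power_mult)
    finally show "(\<Sum>\<sigma>\<in>{\<sigma>\<in>?S. restrict (?bc \<sigma>) ?I = K}. ?f \<sigma>) \<le> ?w"
      unfolding sum_eq by (rule mult_left_mono) simp
  qed
  also have "\<dots> = real (card Ty) * ?w" by simp
  also have "\<dots> \<le> real ((M + 1) ^ (n * n)) * ?w"
    using cardTy by (intro mult_right_mono) (auto simp del: of_nat_power)
  finally have "(\<Sum>\<sigma>\<in>?S. ?f \<sigma>) / fact M ^ (n * n) \<le> real ((M + 1) ^ (n * n)) * ?w / fact M ^ (n * n)"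
    by (rule divide_right_mono) simp
  then show ?thesis
    using assms unfolding balanced_weight_def
    by (subst bethe_perm_deg_all_one) (auto intro!: real_root_le_mono)
qed

section \<open>Stirling's formula\<close>

lemma central_binomial_pochhammer:
  "real ((2 * n) choose n) / 4 ^ n = pochhammer (1/2) n / fact n"
proof -
  have "pochhammer (1/2 :: real) n * 4 ^ n * fact n = fact (2 * n)"
    using fact_double[of n, where 'a = real] by (simp add: power_mult)
  then show ?thesis
    by (simp add: binomial_fact field_simps)
qed

text \<open>For \<open>n > 0\<close> the left side is \<open>sqrt pi\<close> divided by the
  approximant \<open>Gamma_series'\<close> of \<open>Gamma (1/2)\<close>, and
  \<open>Gamma (1/2) = sqrt pi\<close>.\<close>

lemma central_binomial_asymp:
  "(\<lambda>n. real ((2 * n) choose n) / 4 ^ n * sqrt (pi * real n)) \<longlonglongrightarrow> 1"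
proof -
  have "(\<lambda>n. 1 / Gamma_series' (1/2 :: real) n) \<longlonglongrightarrow> 1 / Gamma (1/2)"
    by (intro tendsto_divide tendsto_const Gamma_series'_LIMSEQ) (simp add: Gamma_one_half_real)
  then have "(\<lambda>n. sqrt pi * (1 / Gamma_series' (1/2 :: real) n)) \<longlonglongrightarrow> sqrt pi * (1 / sqrt pi)"
    by (intro tendsto_mult tendsto_const) (simp add: Gamma_one_half_real)
  then have lim: "(\<lambda>n. sqrt pi * (1 / Gamma_series' (1/2 :: real) n)) \<longlonglongrightarrow> 1" by simp
  show ?thesis
  proof (rule Lim_transform_eventually[OF lim])
    show "eventually (\<lambda>n. sqrt pi * (1 / Gamma_series' (1/2 :: real) n) =
        real ((2 * n) choose n) / 4 ^ n * sqrt (pi * real n)) at_top"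
      using eventually_gt_at_top[of 0]
    proof eventually_elim
      case (elim n)
      have e: "exp (1/2 * ln (real n)) = sqrt (real n)"
        using elim by (simp add: powr_half_sqrt[symmetric] powr_def)
      have "real n = sqrt (real n) * sqrt (real n)" by simp
      moreover have "fact n = real n * fact (n - 1)" using elim by (simp add: fact_reduce)
      ultimately show ?case
        unfolding central_binomial_pochhammer Gamma_series'_def using e elim
        by (simp add: real_sqrt_mult field_simps)
    qed
  qed
qed

text \<open>The increments are \<open>1 - (n + 1/2) * ln (1 + 1/n)\<close>. The shift by
  \<open>1/2\<close> cancels the term of order \<open>1/n\<close>, so they are of order
  \<open>1/n^2\<close> and telescoping gives convergence.\<close>

lemma stirling_log_ratio_converges:
  "convergent (\<lambda>n. ln (fact n :: real) - ((real n + 1/2) * ln (real n) - real n))"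
proof -
  define d where "d n = ln (fact n :: real) - ((real n + 1/2) * ln (real n) - real n)" for n
  have "(\<lambda>n::nat. 1 - (real n + 1/2) * ln (1 + 1 / real n)) \<in> O(\<lambda>n. 1 / real n ^ 2)"
    by real_asymp
  moreover have "eventually (\<lambda>n. d (Suc n) - d n = 1 - (real n + 1/2) * ln (1 + 1 / real n)) at_top"
    using eventually_gt_at_top[of 0]
  proof eventually_elim
    case (elim n)
    have "ln (1 + 1 / real n) = ln (real (Suc n)) - ln (real n)"
      using elim ln_div[of "real (Suc n)" "real n"] by (simp add: add_divide_distrib add.commute)
    moreover have "ln (fact (Suc n) :: real) = ln (real (Suc n)) + ln (fact n)"
      by (simp add: ln_mult del: of_nat_Suc)
    moreover have "real (Suc n) + 1/2 = real n + 1/2 + 1" "real (Suc n) = real n + 1" by simp_all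
    ultimately show ?case
      unfolding d_def by (simp only:) (simp add: algebra_simps)
  qed
  ultimately have "(\<lambda>n. d (Suc n) - d n) \<in> O(\<lambda>n. 1 / real n ^ 2)"
    by (subst landau_o.big.in_cong) auto
  then have "summable (\<lambda>n. d (Suc n) - d n)"
    by (rule summable_comparison_test_bigo[rotated]) (use inverse_power_summable[of 2, where 'a = real] in \<open>simp add: divide_inverse\<close>)
  then have "convergent (\<lambda>n. d 0 + (\<Sum>i<n. d (Suc i) - d i))"
    by (intro convergent_add convergent_const) (simp add: summable_iff_convergent)
  also have "(\<lambda>n. d 0 + (\<Sum>i<n. d (Suc i) - d i)) = d"
    by (simp add: sum_lessThan_telescope)
  finally show ?thesis by (simp add: d_def [abs_def])
qed

text \<open>The preceding lemma leaves only the constant \<open>exp L\<close> unknown. The quotient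
  of \<open>r (2 * n)\<close> by the square of \<open>r n\<close> tends to \<open>1 / exp L\<close>
  and is, up to the factor \<open>sqrt (2 * pi)\<close>, the normalised central binomial
  coefficient; hence \<open>exp L = sqrt (2 * pi)\<close>.\<close>

lemma stirling: "(\<lambda>n. fact n / (sqrt (2 * pi * real n) * (real n / exp 1) ^ n)) \<longlonglongrightarrow> 1"
proof -
  define r where "r n = fact n / (sqrt (real n) * (real n / exp 1) ^ n)" for n :: nat
  obtain L where L: "(\<lambda>n. ln (fact n :: real) - ((real n + 1/2) * ln (real n) - real n)) \<longlonglongrightarrow> L"
    using stirling_log_ratio_converges by (auto simp: convergent_def)
  have r: "r \<longlonglongrightarrow> exp L"
  proof (rule Lim_transform_eventually[OF tendsto_exp[OF L]])
    show "eventually (\<lambda>n. exp (ln (fact n :: real) - ((real n + 1/2) * ln (real n) - real n)) = r n) at_top"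
      using eventually_gt_at_top[of 0]
    proof eventually_elim
      case (elim n)
      have "exp ((real n + 1/2) * ln (real n) - real n) =
          exp (1/2 * ln (real n)) * (exp (real n * ln (real n)) / exp (real n))"
        by (simp add: exp_diff exp_add ring_distribs)
      also have "\<dots> = sqrt (real n) * (real n / exp 1) ^ n"
        using elim by (simp add: powr_half_sqrt[symmetric] powr_def power_divide
            exp_of_nat_mult exp_of_nat_mult[of n 1, simplified])
      finally show ?case by (simp add: exp_diff r_def)
    qed
  qed
  have "(\<lambda>n. r (2 * n) / (r n)\<^sup>2) \<longlonglongrightarrow> exp L / (exp L)\<^sup>2"
    by (intro tendsto_divide tendsto_power r filterlim_compose[OF r])
       (auto simp: filterlim_subseq strict_mono_def)
  then have "(\<lambda>n. r (2 * n) / (r n)\<^sup>2 * sqrt (2 * pi)) \<longlonglongrightarrow> exp L / (exp L)\<^sup>2 * sqrt (2 * pi)"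
    by (rule tendsto_mult[OF _ tendsto_const])
  moreover have "eventually (\<lambda>n. r (2 * n) / (r n)\<^sup>2 * sqrt (2 * pi) =
      real ((2 * n) choose n) / 4 ^ n * sqrt (pi * real n)) at_top"
    using eventually_gt_at_top[of 0]
  proof eventually_elim
    case (elim n)
    have "(2 * real n / exp 1) ^ (2 * n) = ((2 * (real n / exp 1)) ^ n)\<^sup>2"
      by (simp add: power_mult[symmetric] mult.commute)
    also have "\<dots> = 4 ^ n * ((real n / exp 1) ^ n)\<^sup>2"
    proof -
      have "(4::real) ^ n = (2 ^ n)\<^sup>2" by (simp add: power2_eq_square flip: power_mult_distrib)
      then show ?thesis by (simp add: power_mult_distrib power_divide)
    qed
    finally have "(2 * real n / exp 1) ^ (2 * n) = 4 ^ n * ((real n / exp 1) ^ n)\<^sup>2" .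
    moreover have "real ((2 * n) choose n) = fact (2 * n) / (fact n)\<^sup>2"
      by (simp add: binomial_fact power2_eq_square)
    moreover have "F2 / (sqrt 2 * s * (q * x\<^sup>2)) / (F / (s * x))\<^sup>2 * (sqrt 2 * sqrt pi) = F2 / F\<^sup>2 / q * (sqrt pi * s)"
      if "s > 0" "x > 0" "q > 0" "F > 0" for F2 s q x F :: real
      using that by (simp add: power2_eq_square field_simps)
    note alg = this[of "sqrt (real n)" "(real n / exp 1) ^ n" "4 ^ n" "fact n" "fact (2 * n)"]
    ultimately show ?case using elim alg
      by (simp add: r_def real_sqrt_mult)
  qed
  ultimately have "(\<lambda>n. real ((2 * n) choose n) / 4 ^ n * sqrt (pi * real n))
      \<longlonglongrightarrow> exp L / (exp L)\<^sup>2 * sqrt (2 * pi)"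
    by (rule Lim_transform_eventually)
  from LIMSEQ_unique[OF this central_binomial_asymp] have C: "exp L = sqrt (2 * pi)"
    by (simp add: power2_eq_square field_simps)
  have "(\<lambda>n. r n / sqrt (2 * pi)) \<longlonglongrightarrow> exp L / sqrt (2 * pi)"
    by (intro tendsto_divide r tendsto_const) auto
  then show ?thesis by (simp add: C r_def real_sqrt_mult mult_ac)
qed

section \<open>The Bethe permanent of the all-one matrix\<close>

text \<open>Since \<open>ln (fact m) = m * ln m - m + o(m)\<close>, subtracting
  \<open>c M * ln M\<close> leaves \<open>c M * (ln (c M / M) - 1) + o(M)\<close>, which has a
  finite limit on the scale \<open>M\<close>.\<close>

lemma ln_fact_scaled_limit:
  fixes c :: "nat \<Rightarrow> nat"
  assumes lim: "(\<lambda>M. real (c M) / real M) \<longlonglongrightarrow> d" and d: "d > 0"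
  shows "(\<lambda>M. (ln (fact (c M)) - real (c M) * ln (real M)) / real M) \<longlonglongrightarrow> d * ln d - d"
proof -
  define e where "e m = ln (fact m :: real) - (real m * ln (real m) - real m)" for m
  have e: "(\<lambda>m. e m / real m) \<longlonglongrightarrow> 0"
  proof -
    obtain L where L: "(\<lambda>n. ln (fact n :: real) - ((real n + 1/2) * ln (real n) - real n)) \<longlonglongrightarrow> L"
      using stirling_log_ratio_converges by (auto simp: convergent_def)
    have "(\<lambda>n. (ln (fact n :: real) - ((real n + 1/2) * ln (real n) - real n)) / real n + ln (real n) / 2 / real n) \<longlonglongrightarrow> 0 + 0"
    proof (rule tendsto_add)
      show "(\<lambda>n. (ln (fact n :: real) - ((real n + 1/2) * ln (real n) - real n)) / real n) \<longlonglongrightarrow> 0"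
        by (rule tendsto_divide_0[OF L]) (rule filterlim_at_top_imp_at_infinity, rule filterlim_real_sequentially)
      show "(\<lambda>n. ln (real n) / 2 / real n) \<longlonglongrightarrow> 0" by real_asymp
    qed
    moreover have "ln (fact n :: real) - ((real n + 1/2) * ln (real n) - real n) + ln (real n) / 2 = e n" for n
      by (simp add: e_def algebra_simps)
    ultimately show ?thesis by (simp only: add_divide_distrib[symmetric] add_0_left)
  qed
  have c_top: "filterlim c at_top at_top"
  proof -
    have "filterlim (\<lambda>M. real (c M) / real M * real M) at_top at_top"
      by (rule filterlim_tendsto_pos_mult_at_top[OF lim d filterlim_real_sequentially])
    moreover have "eventually (\<lambda>M. real (c M) / real M * real M = real (c M)) at_top"
      using eventually_gt_at_top[of 0] by eventually_elim simp
    ultimately have "filterlim (\<lambda>M. real (c M)) at_top at_top"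
      using filterlim_cong[OF refl refl] by fast
    then show ?thesis by (simp add: filterlim_sequentially_iff_filterlim_real)
  qed
  have "(\<lambda>M. e (c M) / real (c M) * (real (c M) / real M) +
      real (c M) / real M * (ln (real (c M) / real M) - 1)) \<longlonglongrightarrow> 0 * d + d * (ln d - 1)"
    by (intro tendsto_intros lim filterlim_compose[OF e c_top]) (use d in auto)
  moreover have "eventually (\<lambda>M. e (c M) / real (c M) * (real (c M) / real M) +
      real (c M) / real M * (ln (real (c M) / real M) - 1) =
      (ln (fact (c M)) - real (c M) * ln (real M)) / real M) at_top"
    using eventually_gt_at_top[of 0] eventually_compose_filterlim[OF eventually_gt_at_top[of 0] c_top]
  proof eventually_elim
    case (elim M)
    then show ?case by (simp add: e_def ln_div field_simps)
  qed
  ultimately show ?thesis by (auto simp: right_diff_distrib elim: Lim_transform_eventually)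
qed

lemma ln_balanced_weight_limit:
  assumes n: "n \<ge> 2"
  shows "(\<lambda>M. ln (balanced_weight n M) / real M) \<longlonglongrightarrow>
    real n * ln (real n) + real n * (real n - 1) * ln (1 - 1 / real n)"
proof -
  let ?q = "\<lambda>M. M div n"
  let ?A = "\<lambda>c M. (ln (fact (c M)) - real (c M) * ln (real M)) / real M"
  \<comment> \<open>The remainder \<open>M mod n\<close> is bounded, so the rounding in
    \<open>M div n\<close> vanishes in the limit.\<close>
  have mod_lim: "(\<lambda>M. real (M mod n) * g M) \<longlonglongrightarrow> 0" if "g \<longlonglongrightarrow> 0" for g :: "nat \<Rightarrow> real"
  proof (rule Lim_null_comparison)
    show "\<forall>\<^sub>F M in sequentially. norm (real (M mod n) * g M) \<le> real n * \<bar>g M\<bar>"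
    proof (intro always_eventually allI)
      fix M
      have "real (M mod n) \<le> real n" using n by (simp add: less_imp_le)
      then show "norm (real (M mod n) * g M) \<le> real n * \<bar>g M\<bar>"
        by (simp add: abs_mult mult_right_mono)
    qed
    show "(\<lambda>M. real n * \<bar>g M\<bar>) \<longlonglongrightarrow> 0"
      using tendsto_mult[OF tendsto_const[of "real n"] tendsto_rabs_zero[OF that]] by simp
  qed
  have q_eq: "real (?q M) = real M / real n - real (M mod n) / real n" for M
    using n by (simp add: real_of_nat_div field_simps) (metis of_nat_add of_nat_mult mod_mult_div_eq)
  have qM: "real (M - ?q M) = real M - real (?q M)" for M by (simp add: of_nat_diff)
  have q: "(\<lambda>M. real (?q M) / real M) \<longlonglongrightarrow> 1 / real n"
  proof -
    have "(\<lambda>M. 1 / real n - real (M mod n) * (1 / (real n * real M))) \<longlonglongrightarrow> 1 / real n - 0"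
      by (intro tendsto_diff tendsto_const mod_lim) (use n in real_asymp)
    moreover have "eventually (\<lambda>M. 1 / real n - real (M mod n) * (1 / (real n * real M)) = real (?q M) / real M) at_top"
      using eventually_gt_at_top[of 0] by eventually_elim (use n in \<open>simp add: q_eq field_simps\<close>)
    ultimately show ?thesis by (auto elim: Lim_transform_eventually)
  qed
  have q': "(\<lambda>M. real (M - ?q M) / real M) \<longlonglongrightarrow> 1 - 1 / real n"
  proof -
    have "(\<lambda>M. 1 - real (?q M) / real M) \<longlonglongrightarrow> 1 - 1 / real n" by (intro tendsto_intros q)
    moreover have "eventually (\<lambda>M. 1 - real (?q M) / real M = real (M - ?q M) / real M) at_top"
      using eventually_gt_at_top[of 0] by eventually_elim (simp add: qM diff_divide_distrib)
    ultimately show ?thesis by (rule Lim_transform_eventually)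
  qed
  have one: "(\<lambda>M::nat. real M / real M) \<longlonglongrightarrow> 1"
    by real_asymp
  have ln_lim: "(\<lambda>M::nat. ln (real M) / real M) \<longlonglongrightarrow> 0"
    by real_asymp
  \<comment> \<open>In the logarithm of \<open>balanced_weight\<close> the term
    \<open>ln (fact M)\<close> has coefficient \<open>2 * n - n^2\<close>. The terms
    \<open>c M * ln M\<close> subtracted inside \<open>?A\<close> add up to
    \<open>2 * n * (M - n * (M div n)) * ln M\<close>, that is
    \<open>2 * n * (M mod n) * ln M\<close>, and the last summand restores them.\<close>
  let ?G = "\<lambda>M. (2 * real n - real n ^ 2) * ?A (\<lambda>M. M) M + real n ^ 2 * (?A (\<lambda>M. M - ?q M) M - ?A ?q M)
      + 2 * real n * (real (M mod n) * (ln (real M) / real M))"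
  have lim: "?G \<longlonglongrightarrow> (2 * real n - real n ^ 2) * (1 * ln 1 - 1) +
      real n ^ 2 * (((1 - 1 / real n) * ln (1 - 1 / real n) - (1 - 1 / real n)) - (1 / real n * ln (1 / real n) - 1 / real n))
      + 2 * real n * 0"
    by (intro tendsto_add tendsto_mult tendsto_diff tendsto_const ln_fact_scaled_limit q q' one mod_lim ln_lim)
       (use n in auto)
  have "(2 * real n - real n ^ 2) * (1 * ln 1 - 1) +
      real n ^ 2 * (((1 - 1 / real n) * ln (1 - 1 / real n) - (1 - 1 / real n)) - (1 / real n * ln (1 / real n) - 1 / real n))
      + 2 * real n * 0 = real n * ln (real n) + real n * (real n - 1) * ln (1 - 1 / real n)"
    using n by (simp add: ln_div field_simps power2_eq_square)
  with lim have "?G \<longlonglongrightarrow> real n * ln (real n) + real n * (real n - 1) * ln (1 - 1 / real n)"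
    by (simp only:)
  moreover have "eventually (\<lambda>M. ?G M = ln (balanced_weight n M) / real M) at_top"
    using eventually_gt_at_top[of 0]
  proof eventually_elim
    case (elim M)
    have "ln (balanced_weight n M) = real (2 * n) * ln (fact M) +
        real (n * n) * (ln (fact (M - ?q M)) - ln (fact (?q M))) - real (n * n) * ln (fact M)"
      by (simp add: balanced_weight_def ln_mult ln_div ln_realpow del: of_nat_mult)
    moreover have "real (M mod n) = real M - real n * real (?q M)"
      using n by (simp add: q_eq field_simps)
    moreover have "(2 * N - N ^ 2) * ((a - m * L) / m) + N ^ 2 * ((b - (m - q) * L) / m - (c - q * L) / m)
        + 2 * N * ((m - N * q) * (L / m)) = (2 * N * a + N * N * (b - c) - N * N * a) / m"
      if "m > 0" for N a m L b q c :: real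
      using that by (simp add: field_simps power2_eq_square)
    ultimately show ?case using elim
      by (simp only: qM of_nat_mult of_nat_numeral of_nat_0_less_iff)
  qed
  ultimately show ?thesis by (rule Lim_transform_eventually)
qed

text \<open>The exponential form of \<open>n^n * (1 - 1/n)^(n * (n - 1))\<close> for
  \<open>n \<ge> 2\<close>, matching the limit of the logarithms above.\<close>

definition bethe_limit :: "nat \<Rightarrow> real" where
  "bethe_limit n = exp (real n * ln (real n) + real n * (real n - 1) * ln (1 - 1 / real n))"

lemma balanced_weight_pos: "balanced_weight n M > 0"
  by (simp add: balanced_weight_def)

text \<open>Under the root of order \<open>M\<close> the polynomial factor of the upper bound tends
  to 1, so both bounds have the same limit. The lower bound is available along the multiples of
  \<open>n\<close>, and a limit superior dominates that of any subsequence.\<close>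

lemma bethe_perm_all_one:
  assumes n: "n \<ge> 2"
  shows "bethe_perm (all_one_mat n) = bethe_limit n"
proof -
  let ?x = "\<lambda>M. bethe_perm_deg M (all_one_mat n)"
  let ?u = "\<lambda>M. root M (real ((M + 1) ^ (n * n)) * balanced_weight n M)"
  let ?l = "\<lambda>q. root (q * n) (balanced_weight n (q * n))"
  have root_eq: "root M x = exp (ln x / real M)" if "M > 0" "x > 0" for M and x :: real
    using that by (metis exp_ln ln_root real_root_gt_zero)
  have u: "?u \<longlonglongrightarrow> bethe_limit n"
  proof -
    have "(\<lambda>M. real (n * n) * (ln (real M + 1) / real M) + ln (balanced_weight n M) / real M) \<longlonglongrightarrow>
        real (n * n) * 0 + (real n * ln (real n) + real n * (real n - 1) * ln (1 - 1 / real n))"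
      by (intro tendsto_add tendsto_mult tendsto_const ln_balanced_weight_limit n) real_asymp
    from tendsto_exp[OF this]
    have "(\<lambda>M. exp (real (n * n) * (ln (real M + 1) / real M) + ln (balanced_weight n M) / real M)) \<longlonglongrightarrow> bethe_limit n"
      by (simp add: bethe_limit_def)
    moreover have "eventually (\<lambda>M. exp (real (n * n) * (ln (real M + 1) / real M) + ln (balanced_weight n M) / real M) = ?u M) at_top"
      using eventually_gt_at_top[of 0]
    proof eventually_elim
      case (elim M)
      have "ln (real ((M + 1) ^ (n * n)) * balanced_weight n M) = real (n * n) * ln (real M + 1) + ln (balanced_weight n M)"
        using balanced_weight_pos[of n M] by (simp add: ln_mult ln_realpow add.commute del: of_nat_mult)
      then show ?case
        using elim balanced_weight_pos[of n M] by (subst root_eq) (simp_all add: add_divide_distrib)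
    qed
    ultimately show ?thesis by (rule Lim_transform_eventually)
  qed
  have mono: "strict_mono (\<lambda>q. q * n)" using n by (auto simp: strict_mono_def)
  have l: "?l \<longlonglongrightarrow> bethe_limit n"
  proof -
    have "(\<lambda>M. exp (ln (balanced_weight n M) / real M)) \<longlonglongrightarrow> bethe_limit n"
      unfolding bethe_limit_def by (intro tendsto_exp ln_balanced_weight_limit n)
    from LIMSEQ_subseq_LIMSEQ[OF this mono]
    have "(\<lambda>q. exp (ln (balanced_weight n (q * n)) / real (q * n))) \<longlonglongrightarrow> bethe_limit n"
      by (simp add: o_def)
    moreover have "eventually (\<lambda>q. exp (ln (balanced_weight n (q * n)) / real (q * n)) = ?l q) at_top"
      using eventually_gt_at_top[of 0]
      by eventually_elim (use n balanced_weight_pos in \<open>simp add: root_eq\<close>)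
    ultimately show ?thesis by (rule Lim_transform_eventually)
  qed
  have "limsup (\<lambda>M. ereal (?x M)) \<le> limsup (\<lambda>M. ereal (?u M))"
    using eventually_gt_at_top[of 0]
    by (intro Limsup_mono, eventually_elim) (use n bethe_perm_deg_le_balanced_weight in simp)
  also have "\<dots> = ereal (bethe_limit n)"
    by (rule lim_imp_Limsup) (use u in auto)
  finally have le: "limsup (\<lambda>M. ereal (?x M)) \<le> ereal (bethe_limit n)" .
  have "ereal (bethe_limit n) = limsup (\<lambda>q. ereal (?l q))"
    by (rule lim_imp_Limsup[symmetric]) (use l in auto)
  also have "\<dots> \<le> limsup ((\<lambda>M. ereal (?x M)) \<circ> (\<lambda>q. q * n))"
    using eventually_gt_at_top[of 0] unfolding o_def
    by (intro Limsup_mono, eventually_elim) (use n balanced_weight_le_bethe_perm_deg in simp)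
  also have "\<dots> \<le> limsup (\<lambda>M. ereal (?x M))"
    by (rule limsup_subseq_mono[OF mono])
  finally have "limsup (\<lambda>M. ereal (?x M)) = ereal (bethe_limit n)" using le by (rule antisym[rotated])
  then show ?thesis by (simp add: bethe_perm_def)
qed

lemma permanent_all_one: "permanent (all_one_mat n) = fact n"
  by (simp add: permanent_def all_one_mat_def card_permutations permutes_in_image[of _ "{0..<n}", simplified])

lemma permanent_div_bethe_perm_all_one:
  "(\<lambda>n. permanent (all_one_mat n) / bethe_perm (all_one_mat n)) \<sim>[at_top]
     (\<lambda>n. sqrt (2 * pi * real n / exp 1))"
proof (rule asymp_equivI')
  let ?r = "\<lambda>n. fact n / (sqrt (2 * pi * real n) * (real n / exp 1) ^ n)"
  \<comment> \<open>The expansion \<open>n * (n - 1) * ln (1 - 1/n) = -n + 1/2 + o(1)\<close>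
    cancels the \<open>exp (-n)\<close> of Stirling's formula and leaves the factor
    \<open>exp (-1/2)\<close>, the source of the \<open>e\<close> under the square root.\<close>
  have "(\<lambda>n. exp (1/2 - real n - real n * (real n - 1) * ln (1 - 1 / real n))) \<longlonglongrightarrow> 1"
    by real_asymp
  from tendsto_mult[OF stirling this]
  have "(\<lambda>n. ?r n * exp (1/2 - real n - real n * (real n - 1) * ln (1 - 1 / real n))) \<longlonglongrightarrow> 1"
    by simp
  moreover have "eventually (\<lambda>n. ?r n * exp (1/2 - real n - real n * (real n - 1) * ln (1 - 1 / real n)) =
      permanent (all_one_mat n) / bethe_perm (all_one_mat n) / sqrt (2 * pi * real n / exp 1)) at_top"
    using eventually_ge_at_top[of 2]
  proof eventually_elim
    case (elim n)
    have "(real n / exp 1) ^ n = exp (real n * ln (real n) - real n)"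
      using elim by (simp add: exp_diff exp_of_nat_mult power_divide exp_of_nat_mult[of n 1, simplified])
    moreover have "sqrt (exp 1) = exp (1/2 :: real)"
      by (simp add: real_sqrt_unique power2_eq_square flip: exp_add)
    moreover have "F / (s * exp (L - x)) * exp (1/2 - x - B) = F / exp (L + B) / (s / exp (1/2))"
      if "s \<noteq> 0" for F s L x B :: real
    proof -
      have "exp (1/2 - x - B) / exp (L - x) = exp (1/2) / exp (L + B)" by (simp flip: exp_diff)
      then show ?thesis using that by (simp add: field_simps)
    qed
    ultimately show ?case using elim
      by (simp only: permanent_all_one bethe_perm_all_one bethe_limit_def real_sqrt_divide) simp
  qed
  ultimately show "(\<lambda>n. permanent (all_one_mat n) / bethe_perm (all_one_mat n) / sqrt (2 * pi * real n / exp 1)) \<longlonglongrightarrow> 1"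
    by (rule Lim_transform_eventually)
qed

section \<open>The Bethe permanent of degree 2\<close>

lemma card_div_preimage:
  fixes M :: nat
  assumes "S \<subseteq> {0..<n}"
  shows "card {x\<in>{0..<M * n}. x div M \<in> S} = M * card S"
proof -
  have "card {x\<in>{0..<M * n}. x div M \<in> S} = card (\<Union>i\<in>S. {x\<in>{0..<M * n}. x div M = i})"
    by (intro arg_cong[of _ _ card]) auto
  also have "\<dots> = (\<Sum>i\<in>S. card {x\<in>{0..<M * n}. x div M = i})"
    using assms by (intro card_UN_disjoint) (auto intro: finite_subset)
  also have "\<dots> = (\<Sum>i\<in>S. M)"
    using assms by (intro sum.cong card_div_fibre) auto
  finally show ?thesis by simp
qed

text \<open>Each block \<open>i\<close> in \<open>S\<close> is carried onto block
  \<open>\<pi> i\<close> in \<open>fact M\<close> ways, and the other rows are matched freely with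
  the remaining columns. Labelling by the target block, or \<open>None\<close>, reduces this to
  \<open>card_permutes_fibres\<close>.\<close>

lemma card_permutes_block_map:
  fixes \<pi> :: "nat \<Rightarrow> nat"
  assumes S: "S \<subseteq> {0..<n}" and \<pi>: "\<pi> ` S \<subseteq> {0..<n}" "inj_on \<pi> S"
  shows "card {\<sigma>. \<sigma> permutes {0..<M * n} \<and> (\<forall>x\<in>{0..<M * n}. x div M \<in> S \<longrightarrow> \<sigma> x div M = \<pi> (x div M))} =
    fact M ^ card S * fact (M * (n - card S))"
proof -
  let ?X = "{0..<M * n}"
  define c where "c x = (if x div M \<in> S then Some (\<pi> (x div M)) else None)" for x
  define g where "g y = (if y div M \<in> \<pi> ` S then Some (y div M) else None)" for y
  have finS: "finite S" using S finite_subset by blast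
  have cardS: "card S \<le> n" using card_mono[OF _ S] by simp
  have c_Some: "card {x\<in>?X. c x = Some (\<pi> i)} = M" and g_Some: "card {x\<in>?X. g x = Some (\<pi> i)} = M"
    if i: "i \<in> S" for i
  proof -
    have "{x\<in>?X. c x = Some (\<pi> i)} = {x\<in>?X. x div M = i}" "{x\<in>?X. g x = Some (\<pi> i)} = {x\<in>?X. x div M = \<pi> i}"
      using i \<pi>(2) by (auto simp: c_def g_def dest: inj_onD)
    moreover have "i < n" "\<pi> i < n" using i S \<pi>(1) by auto
    ultimately show "card {x\<in>?X. c x = Some (\<pi> i)} = M" "card {x\<in>?X. g x = Some (\<pi> i)} = M"
      by (simp_all only: card_div_fibre)
  qed
  have compl: "card {x\<in>?X. x div M \<notin> T} = M * (n - card T)" if "T \<subseteq> {0..<n}" for T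
  proof -
    have "{x\<in>?X. x div M \<notin> T} = ?X - {x\<in>?X. x div M \<in> T}" by auto
    moreover have "card (?X - {x\<in>?X. x div M \<in> T}) = card ?X - card {x\<in>?X. x div M \<in> T}"
      by (rule card_Diff_subset) auto
    ultimately show ?thesis using card_div_preimage[OF that, of M]
      by (simp only: card_atLeastLessThan diff_zero diff_mult_distrib2)
  qed
  have "{x\<in>?X. c x = None} = {x\<in>?X. x div M \<notin> S}" "{x\<in>?X. g x = None} = {x\<in>?X. x div M \<notin> \<pi> ` S}"
    by (auto simp: c_def g_def)
  then have c_None: "card {x\<in>?X. c x = None} = M * (n - card S)" and g_None: "card {x\<in>?X. g x = None} = M * (n - card S)"
    by (simp_all only: compl[OF S] compl[OF \<pi>(1)] card_image[OF \<pi>(2)])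
  have equiv: "(\<forall>x\<in>?X. x div M \<in> S \<longrightarrow> \<sigma> x div M = \<pi> (x div M)) \<longleftrightarrow> (\<forall>x\<in>?X. g (\<sigma> x) = c x)"
    if \<sigma>: "\<sigma> permutes ?X" for \<sigma>
  proof
    assume *: "\<forall>x\<in>?X. x div M \<in> S \<longrightarrow> \<sigma> x div M = \<pi> (x div M)"
    let ?A = "{x\<in>?X. x div M \<in> S}" and ?B = "{x\<in>?X. x div M \<in> \<pi> ` S}"
    \<comment> \<open>The assumption only sends \<open>?A\<close> into \<open>?B\<close>. Equal
      cardinalities make this onto, so the points outside \<open>?A\<close> must avoid
      \<open>?B\<close>.\<close>
    have "\<sigma> ` ?A \<subseteq> ?B" using * permutes_in_image[OF \<sigma>] by blast
    moreover have "card (\<sigma> ` ?A) = card ?B"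
      using card_image[OF permutes_inj_on[OF \<sigma>]] card_div_preimage[OF S] card_div_preimage[OF \<pi>(1)]
        card_image[OF \<pi>(2)] by simp
    ultimately have AB: "\<sigma> ` ?A = ?B" by (intro card_subset_eq) auto
    show "\<forall>x\<in>?X. g (\<sigma> x) = c x"
    proof
      fix x assume x: "x \<in> ?X"
      show "g (\<sigma> x) = c x"
      proof (cases "x div M \<in> S")
        case True
        then show ?thesis using * x by (simp add: g_def c_def)
      next
        case False
        have "\<sigma> x \<notin> \<sigma> ` ?A"
          using False permutes_inj[OF \<sigma>] by (auto dest: injD)
        moreover have "\<sigma> x \<in> ?X" using x permutes_in_image[OF \<sigma>] by blast
        ultimately have "\<sigma> x div M \<notin> \<pi> ` S" unfolding AB by blast
        then show ?thesis using False by (simp add: g_def c_def)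
      qed
    qed
  next
    assume *: "\<forall>x\<in>?X. g (\<sigma> x) = c x"
    show "\<forall>x\<in>?X. x div M \<in> S \<longrightarrow> \<sigma> x div M = \<pi> (x div M)"
    proof (intro ballI impI)
      fix x assume "x \<in> ?X" "x div M \<in> S"
      then have "g (\<sigma> x) = Some (\<pi> (x div M))" using * by (simp add: c_def)
      then show "\<sigma> x div M = \<pi> (x div M)" by (simp add: g_def split: if_splits)
    qed
  qed
  have "{\<sigma>. \<sigma> permutes ?X \<and> (\<forall>x\<in>?X. x div M \<in> S \<longrightarrow> \<sigma> x div M = \<pi> (x div M))} =
      {\<sigma>. \<sigma> permutes ?X \<and> (\<forall>x\<in>?X. g (\<sigma> x) = c x)}"
    using equiv by blast
  moreover have "card {\<sigma>. \<sigma> permutes ?X \<and> (\<forall>x\<in>?X. g (\<sigma> x) = c x)} =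
      (\<Prod>j\<in>insert None (Some ` \<pi> ` S). fact (card {x\<in>?X. c x = j}))"
  proof (rule card_permutes_fibres)
    show "c ` ?X \<subseteq> insert None (Some ` \<pi> ` S)" by (auto simp: c_def)
    show "card {x\<in>?X. g x = j} = card {x\<in>?X. c x = j}" if "j \<in> insert None (Some ` \<pi> ` S)" for j
      using that c_None g_None c_Some g_Some by force
  qed (use finS in auto)
  moreover have "(\<Prod>j\<in>insert None (Some ` \<pi> ` S). fact (card {x\<in>?X. c x = j})) =
      (fact (M * (n - card S)) * (\<Prod>j\<in>Some ` \<pi> ` S. fact (card {x\<in>?X. c x = j})) :: nat)"
    using finS by (subst prod.insert) (auto simp only: c_None finite_imageI image_iff option.distinct)
  moreover have "(\<Prod>j\<in>Some ` \<pi> ` S. fact (card {x\<in>?X. c x = j})) = (\<Prod>j\<in>Some ` \<pi> ` S. fact M :: nat)"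
    by (intro prod.cong refl) (use c_Some in force)
  moreover have "card (Some ` \<pi> ` S) = card S"
    using \<pi>(2) by (simp add: card_image)
  ultimately show ?thesis by (simp only: prod_constant mult.commute)
qed

lemma prod_falling_fact: "k \<le> n \<Longrightarrow> (\<Prod>t\<in>{0..<k}. n - t) * fact (n - k) = fact n"
proof (induction k)
  case (Suc k)
  then have "fact (n - k) = (n - k) * fact (n - Suc k)"
    using fact_reduce[of "n - k", where 'a = nat] by simp
  with Suc show ?case by (simp add: mult.assoc)
qed simp

text \<open>Such a \<open>\<sigma>\<close> induces an injection \<open>\<pi>\<close> from
  \<open>S\<close> to the column blocks, one of \<open>fact n / fact (n - card S)\<close>; the
  permutations inducing a given \<open>\<pi>\<close> are counted by
  \<open>card_permutes_block_map\<close>. The factor \<open>fact (n - card S)\<close> on the left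
  avoids division in the naturals.\<close>

lemma card_permutes_doubled_blocks:
  assumes S: "S \<subseteq> {0..<n}"
  shows "card {\<sigma>. \<sigma> permutes {0..<2 * n} \<and> (\<forall>i\<in>S. \<sigma> (2 * i) div 2 = \<sigma> (2 * i + 1) div 2)} * fact (n - card S) =
    fact n * 2 ^ card S * fact (2 * (n - card S))" (is "card ?T * _ = _")
proof -
  let ?X = "{0..<2 * n}"
  define I where "I = {\<pi> \<in> S \<rightarrow>\<^sub>E {0..<n}. inj_on \<pi> S}"
  define h where "h \<sigma> = restrict (\<lambda>i. \<sigma> (2 * i) div 2) S" for \<sigma> :: "nat \<Rightarrow> nat"
  have finS: "finite S" using S finite_subset by blast
  have cardS: "card S \<le> n" using card_mono[OF _ S] by simp
  have finI: "finite I" unfolding I_def using finS by (simp add: finite_PiE)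
  have finT: "finite ?T"
    by (rule finite_subset[OF _ finite_permutations[of ?X]]) auto
  have "h ` ?T \<subseteq> I"
  proof (rule image_subsetI)
    fix \<sigma> assume "\<sigma> \<in> ?T"
    then have \<sigma>: "\<sigma> permutes ?X" and eq: "\<And>i. i \<in> S \<Longrightarrow> \<sigma> (2 * i) div 2 = \<sigma> (2 * i + 1) div 2"
      by auto
    have "\<sigma> (2 * i) div 2 < n" if "i \<in> S" for i
    proof -
      have "2 * i \<in> ?X" using that S by auto
      then have "\<sigma> (2 * i) \<in> ?X" using permutes_in_image[OF \<sigma>] by blast
      then show ?thesis by auto
    qed
    moreover have "i = i'" if "i \<in> S" "i' \<in> S" "\<sigma> (2 * i) div 2 = \<sigma> (2 * i') div 2" for i i'
    proof (rule ccontr)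
      assume "i \<noteq> i'"
      have inj: "\<sigma> x = \<sigma> y \<longleftrightarrow> x = y" for x y using permutes_inj[OF \<sigma>] by (auto dest: injD)
      \<comment> \<open>If two doubled rows shared a column block, three distinct columns would lie
        in a block of size two.\<close>
      have "\<sigma> (2 * i) \<noteq> \<sigma> (2 * i + 1)" "\<sigma> (2 * i) \<noteq> \<sigma> (2 * i')" "\<sigma> (2 * i + 1) \<noteq> \<sigma> (2 * i')"
        unfolding inj using \<open>i \<noteq> i'\<close> by arith+
      moreover have "x = y \<or> x = z \<or> y = z" if "x div 2 = y div 2" "x div 2 = z div 2" for x y z :: nat
        using that div_mult_mod_eq[of x 2] div_mult_mod_eq[of y 2] div_mult_mod_eq[of z 2]
          mod_less_divisor[of 2 x] mod_less_divisor[of 2 y] mod_less_divisor[of 2 z] by linarith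
      ultimately show False using that(3) eq[OF that(1)] by blast
    qed
    ultimately show "h \<sigma> \<in> I" by (auto simp: h_def I_def inj_on_def)
  qed
  then have "card ?T = (\<Sum>\<pi>\<in>I. card {\<sigma>\<in>?T. h \<sigma> = \<pi>})"
    by (rule card_eq_sum_fibres[OF finT finI])
  also have "\<dots> = (\<Sum>\<pi>\<in>I. 2 ^ card S * fact (2 * (n - card S)))"
  proof (rule sum.cong[OF refl])
    fix \<pi> assume \<pi>: "\<pi> \<in> I"
    have "{\<sigma>\<in>?T. h \<sigma> = \<pi>} =
        {\<sigma>. \<sigma> permutes ?X \<and> (\<forall>x\<in>?X. x div 2 \<in> S \<longrightarrow> \<sigma> x div 2 = \<pi> (x div 2))}" (is "?L = ?R")
    proof (intro equalityI subsetI)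
      fix \<sigma> assume L: "\<sigma> \<in> ?L"
      have "\<sigma> x div 2 = \<pi> (x div 2)" if "x div 2 \<in> S" for x
      proof -
        have "\<pi> (x div 2) = \<sigma> (2 * (x div 2)) div 2" using L that by (auto simp: h_def)
        moreover have "\<sigma> (2 * (x div 2)) div 2 = \<sigma> (2 * (x div 2) + 1) div 2" using L that by auto
        moreover have "x = 2 * (x div 2) \<or> x = 2 * (x div 2) + 1" by presburger
        ultimately show ?thesis by metis
      qed
      then show "\<sigma> \<in> ?R" using L by auto
    next
      fix \<sigma> assume R: "\<sigma> \<in> ?R"
      have *: "\<sigma> (2 * i) div 2 = \<pi> i" "\<sigma> (2 * i + 1) div 2 = \<pi> i" if "i \<in> S" for i
      proof -
        have "2 * i \<in> ?X" "2 * i + 1 \<in> ?X" "2 * i div 2 = i" "(2 * i + 1) div 2 = i"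
          using that S by auto
        then show "\<sigma> (2 * i) div 2 = \<pi> i" "\<sigma> (2 * i + 1) div 2 = \<pi> i"
          using R that by (metis (mono_tags, lifting) mem_Collect_eq)+
      qed
      then have "h \<sigma> = \<pi>" using \<pi> by (auto simp: h_def I_def fun_eq_iff PiE_def extensional_def)
      then show "\<sigma> \<in> ?L" using R * by auto
    qed
    moreover have "card ?R = fact 2 ^ card S * fact (2 * (n - card S))"
      using \<pi> by (intro card_permutes_block_map S) (auto simp: I_def PiE_def)
    ultimately show "card {\<sigma>\<in>?T. h \<sigma> = \<pi>} = 2 ^ card S * fact (2 * (n - card S))" by simp
  qed
  also have "\<dots> = card I * (2 ^ card S * fact (2 * (n - card S)))" by simp
  finally have "card ?T * fact (n - card S) = card I * fact (n - card S) * (2 ^ card S * fact (2 * (n - card S)))"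
    by (simp only: mult_ac)
  moreover have "card I * fact (n - card S) = fact n"
    using card_inj_on_subset_funcset[OF finS, of "{0..<n}" S] prod_falling_fact[OF cardS]
    by (simp add: I_def)
  ultimately show ?thesis by simp
qed

section \<open>The averaged permanent in degree 2\<close>

text \<open>A count of 0 gives the factor 1, a count of 1 or 2 the factor 1/2. The product is
  therefore \<open>(1/2)\<close> to the number of distinct column blocks hit by the two rows, and
  \<open>(1 + e) / 4\<close> covers both cases.\<close>

lemma block_row_weight_2:
  assumes \<sigma>: "\<sigma> permutes {0..<2 * n}" and i: "i < n"
  shows "(\<Prod>j\<in>{0..<n}. fact (2 - block_count 2 n (\<lambda>r. \<sigma> r div 2) (i, j)) / 2) =
    (1 + (if \<sigma> (2 * i) div 2 = \<sigma> (2 * i + 1) div 2 then 1 else 0)) / (4 :: real)"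
proof -
  define a b where "a = \<sigma> (2 * i) div 2" and "b = \<sigma> (2 * i + 1) div 2"
  have ab: "a < n" "b < n"
  proof -
    have "2 * i \<in> {0..<2 * n}" "2 * i + 1 \<in> {0..<2 * n}" using i by auto
    then have "\<sigma> (2 * i) \<in> {0..<2 * n}" "\<sigma> (2 * i + 1) \<in> {0..<2 * n}"
      using permutes_in_image[OF \<sigma>] by blast+
    then show "a < n" "b < n" by (auto simp: a_def b_def)
  qed
  have bc: "block_count 2 n (\<lambda>r. \<sigma> r div 2) (i, j) = (if a = j then 1 else 0) + (if b = j then 1 else 0)" for j
  proof -
    have "{r\<in>{0..<2 * n}. (r div 2, \<sigma> r div 2) = (i, j)} =
        (if a = j then {2 * i} else {}) \<union> (if b = j then {2 * i + 1} else {})"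
    proof -
      have "r = 2 * i \<or> r = 2 * i + 1" if "r div 2 = i" for r
        using that div_mult_mod_eq[of r 2] mod_less_divisor[of 2 r] by linarith
      then have "{r\<in>{0..<2 * n}. r div 2 = i} = {2 * i, 2 * i + 1}"
        using i by (intro equalityI subsetI) (blast, auto)
      then have "{r\<in>{0..<2 * n}. (r div 2, \<sigma> r div 2) = (i, j)} = {r\<in>{2 * i, 2 * i + 1}. \<sigma> r div 2 = j}"
        by blast
      then show ?thesis by (auto simp: a_def b_def)
    qed
    then show ?thesis by (simp add: block_count_def)
  qed
  have "(\<Prod>j\<in>{0..<n}. fact (2 - block_count 2 n (\<lambda>r. \<sigma> r div 2) (i, j)) / 2) =
      (\<Prod>j\<in>{0..<n}. if j \<in> {a, b} then 1 / 2 else (1 :: real))"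
    by (intro prod.cong refl) (auto simp: bc)
  also have "\<dots> = (1 / 2) ^ card {a, b}"
  proof -
    have "{0..<n} \<inter> {a, b} = {a, b}" using ab by auto
    then show ?thesis by (simp add: prod.If_cases del: insert_iff)
  qed
  also have "\<dots> = (1 + (if a = b then 1 else 0)) / 4"
    by (cases "a = b") (auto simp: power2_eq_square)
  finally show ?thesis by (simp add: a_def b_def)
qed

lemma sum_card_Pow:
  assumes "finite A"
  shows "(\<Sum>S\<in>Pow A. f (card S)) = (\<Sum>k\<le>card A. of_nat (card A choose k) * (f k :: 'a :: comm_semiring_1))"
proof -
  have "(\<Sum>S\<in>Pow A. f (card S)) = (\<Sum>k\<le>card A. \<Sum>S\<in>{S\<in>Pow A. card S = k}. f (card S))"
    using assms by (intro sum.group[symmetric]) (auto intro: card_mono)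
  also have "\<dots> = (\<Sum>k\<le>card A. of_nat (card A choose k) * f k)"
    using n_subsets[OF assms] by (intro sum.cong) (auto simp: Pow_def)
  finally show ?thesis .
qed

text \<open>A Cauchy product: \<open>1 / sqrt (1 - x)\<close> has the coefficients
  \<open>(2m choose m) / 4^m\<close>, and the other factor is the series of
  \<open>exp (x/2)\<close>.\<close>

definition bethe_sum_2 :: "nat \<Rightarrow> real" where
  "bethe_sum_2 n = (\<Sum>k\<le>n. (1/2) ^ k / fact k * (real ((2 * (n - k)) choose (n - k)) / 4 ^ (n - k)))"

lemma average_permanent_2:
  "(\<Sum>\<sigma> | \<sigma> permutes {0..<2 * n}.
      \<Prod>b\<in>{0..<n} \<times> {0..<n}. fact (2 - block_count 2 n (\<lambda>r. \<sigma> r div 2) b)) / fact 2 ^ (n * n) =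
    (fact n)\<^sup>2 * bethe_sum_2 n"
proof -
  let ?S = "{\<sigma>. \<sigma> permutes {0..<2 * n}}" and ?I = "{0..<n} \<times> {0..<n}"
  let ?bc = "\<lambda>\<sigma>. block_count 2 n (\<lambda>r. \<sigma> r div 2)"
  let ?e = "\<lambda>\<sigma> i. if \<sigma> (2 * i) div 2 = \<sigma> (2 * i + 1) div 2 then 1 else (0 :: real)"
  \<comment> \<open>\<open>F k\<close> is the number of permutations that keep the two rows together
    in each of \<open>k\<close> given block rows; it depends on \<open>k\<close> alone, so the
    subsets can be summed by size.\<close>
  define F :: "nat \<Rightarrow> real" where "F k = fact n / fact (n - k) * 2 ^ k * fact (2 * (n - k))" for k
  have count: "(\<Sum>\<sigma>\<in>?S. \<Prod>i\<in>A. ?e \<sigma> i) = F (card A)" if A: "A \<subseteq> {0..<n}" for A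
  proof -
    let ?T = "{\<sigma>. \<sigma> permutes {0..<2 * n} \<and> (\<forall>i\<in>A. \<sigma> (2 * i) div 2 = \<sigma> (2 * i + 1) div 2)}"
    have finA: "finite A" using A finite_subset by blast
    have "(\<Sum>\<sigma>\<in>?S. \<Prod>i\<in>A. ?e \<sigma> i) = (\<Sum>\<sigma>\<in>?S. if \<sigma> \<in> ?T then 1 else 0)"
    proof (rule sum.cong[OF refl])
      fix \<sigma> assume "\<sigma> \<in> ?S"
      then show "(\<Prod>i\<in>A. ?e \<sigma> i) = (if \<sigma> \<in> ?T then 1 else 0)"
        using finA by (auto intro: prod.neutral prod_zero)
    qed
    also have "\<dots> = real (card (?S \<inter> ?T))"
      by (subst sum.inter_restrict[symmetric]) (simp_all add: finite_permutations)
    also have "?S \<inter> ?T = ?T" by blast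
    also have "real (card ?T) = F (card A)"
      using arg_cong[OF card_permutes_doubled_blocks[OF A], of real]
      by (simp add: F_def field_simps)
    finally show ?thesis .
  qed
  have "(\<Sum>\<sigma>\<in>?S. \<Prod>b\<in>?I. fact (2 - ?bc \<sigma> b)) / fact 2 ^ (n * n) =
      (\<Sum>\<sigma>\<in>?S. \<Prod>b\<in>?I. fact (2 - ?bc \<sigma> b) / (2 :: real))"
    by (simp add: sum_divide_distrib prod_dividef)
  also have "\<dots> = (\<Sum>\<sigma>\<in>?S. \<Prod>i\<in>{0..<n}. \<Prod>j\<in>{0..<n}. fact (2 - ?bc \<sigma> (i, j)) / (2 :: real))"
    by (simp only: prod.cartesian_product case_prod_unfold prod.collapse)
  also have "\<dots> = (\<Sum>\<sigma>\<in>?S. \<Prod>i\<in>{0..<n}. (1 + ?e \<sigma> i) / 4)"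
    by (intro sum.cong prod.cong refl block_row_weight_2) auto
  also have "\<dots> = (\<Sum>\<sigma>\<in>?S. \<Prod>i\<in>{0..<n}. ?e \<sigma> i + 1) / 4 ^ n"
    by (simp only: prod_dividef prod_constant card_atLeastLessThan diff_zero sum_divide_distrib add.commute)
  also have "(\<Sum>\<sigma>\<in>?S. \<Prod>i\<in>{0..<n}. ?e \<sigma> i + 1) = (\<Sum>A\<in>Pow {0..<n}. \<Sum>\<sigma>\<in>?S. \<Prod>i\<in>A. ?e \<sigma> i)"
    by (subst sum.swap, subst prod_add) (simp_all only: finite_atLeastLessThan prod.neutral_const mult_1_right)
  also have "\<dots> = (\<Sum>A\<in>Pow {0..<n}. F (card A))"
    by (intro sum.cong refl count) blast
  also have "\<dots> = (\<Sum>k\<le>n. real (n choose k) * F k)"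
    using sum_card_Pow[of "{0..<n}" F] by simp
  also have "\<dots> / 4 ^ n = (\<Sum>k\<le>n. (fact n)\<^sup>2 * ((1/2) ^ k / fact k * (real ((2 * (n - k)) choose (n - k)) / 4 ^ (n - k))))"
    unfolding sum_divide_distrib
  proof (rule sum.cong[OF refl])
    fix k assume "k \<in> {..n}"
    then have k: "k \<le> n" by simp
    then obtain m where n: "n = k + m" using le_Suc_ex by blast
    have "(4::real) ^ k = 2 ^ k * 2 ^ k" by (simp flip: power_mult_distrib)
    moreover have "real ((2 * m) choose m) = fact (2 * m) / (fact m * fact m)"
      by (simp add: binomial_fact)
    moreover have "real (n choose k) = fact n / (fact k * fact m)"
      using k by (simp add: binomial_fact n)
    moreover have "n - k = m" using n by simp
    ultimately show "real (n choose k) * F k / 4 ^ n =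
        (fact n)\<^sup>2 * ((1/2) ^ k / fact k * (real ((2 * (n - k)) choose (n - k)) / 4 ^ (n - k)))"
      unfolding F_def by (simp only: power_add n power_divide power_one) (simp add: field_simps power2_eq_square)
  qed
  also have "\<dots> = (fact n)\<^sup>2 * bethe_sum_2 n"
    by (simp add: bethe_sum_2_def sum_distrib_left)
  finally show ?thesis .
qed

lemma bethe_perm_deg_2_all_one:
  "bethe_perm_deg 2 (all_one_mat n) = fact n * sqrt (bethe_sum_2 n)"
  by (subst bethe_perm_deg_all_one) (simp_all only: average_permanent_2, simp_all add: sqrt_def[symmetric] real_sqrt_mult)

section \<open>Asymptotics in degree 2\<close>

text \<open>A bound for every \<open>m\<close>, including 0, is what the domination below requires,
  whence \<open>m + 1\<close> under the root. Induction works because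
  \<open>b m ^ 2 * (m + 1)\<close> is multiplied by
  \<open>(2 * m + 1)^2 * (m + 2) / (4 * (m + 1)^3) \<le> 1\<close> at each step.\<close>

lemma central_binomial_le: "real ((2 * m) choose m) / 4 ^ m \<le> 1 / sqrt (real m + 1)"
proof -
  define b where "b m = pochhammer (1/2) m / (fact m :: real)" for m
  have b_Suc: "b (Suc m) = b m * (2 * real m + 1) / (2 * (real m + 1))" for m
    by (simp add: b_def pochhammer_Suc field_simps)
  have "(b m)\<^sup>2 * (real m + 1) \<le> 1"
  proof (induction m)
    case 0
    then show ?case by (simp add: b_def)
  next
    case (Suc m)
    define x where "x = real m"
    have x: "x \<ge> 0" by (simp add: x_def)
    have "(2 * x + 1)\<^sup>2 * (x + 2) \<le> 4 * (x + 1) ^ 3"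
      using x by (simp add: power2_eq_square power3_eq_cube algebra_simps)
    then have le: "(2 * x + 1)\<^sup>2 * (x + 2) / (4 * (x + 1) ^ 3) \<le> 1"
      using x by (simp add: divide_le_eq)
    have "(b (Suc m))\<^sup>2 * (real (Suc m) + 1) = (b m)\<^sup>2 * (x + 1) * ((2 * x + 1)\<^sup>2 * (x + 2) / (4 * (x + 1) ^ 3))"
      using x unfolding b_Suc x_def[symmetric]
      by (simp add: power_mult_distrib power_divide) (simp add: x_def power2_eq_square power3_eq_cube divide_simps, simp add: algebra_simps)
    also have "\<dots> \<le> 1 * 1"
      using Suc le x by (intro mult_mono) (auto simp: x_def)
    finally show ?case by simp
  qed
  then have "(b m * sqrt (real m + 1))\<^sup>2 \<le> 1" by (simp add: power_mult_distrib)
  then have "b m * sqrt (real m + 1) \<le> 1" by (rule power2_le_imp_le[of _ 1, simplified])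
  then have "b m \<le> 1 / sqrt (real m + 1)" by (simp add: pos_le_divide_eq)
  then show ?thesis by (simp add: central_binomial_pochhammer b_def)
qed

text \<open>After scaling by \<open>sqrt (pi * n)\<close> the \<open>k\<close>-th summand tends to
  \<open>(1/2)^k / k!\<close>, because \<open>n - k\<close> and \<open>n\<close> are asymptotically
  equal for fixed \<open>k\<close>. Tannery's theorem lets the limits be summed, and the resulting
  series is \<open>exp (1/2)\<close>.\<close>

lemma bethe_sum_2_asymp: "(\<lambda>n. bethe_sum_2 n * sqrt (pi * real n)) \<longlonglongrightarrow> exp (1/2)"
proof -
  define b where "b m = real ((2 * m) choose m) / 4 ^ m" for m
  define a where "a k n = (if k \<le> n then (1/2) ^ k / fact k * b (n - k) * sqrt (pi * real n) else 0)" for k n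
  have lim: "(\<lambda>n. a k n) \<longlonglongrightarrow> (1/2) ^ k / fact k" for k
  proof -
    \<comment> \<open>The shift from \<open>n\<close> to \<open>n + k\<close> removes the truncated
      difference \<open>n - k\<close>.\<close>
    have "(\<lambda>n. b (n + k - k) * sqrt (pi * real (n + k - k)) * sqrt (real (n + k) / real n)) \<longlonglongrightarrow> 1 * 1"
    proof (intro tendsto_mult)
      show "(\<lambda>n. b (n + k - k) * sqrt (pi * real (n + k - k))) \<longlonglongrightarrow> 1"
        using central_binomial_asymp by (simp add: b_def)
      show "(\<lambda>n. sqrt (real (n + k) / real n)) \<longlonglongrightarrow> 1" by real_asymp
    qed
    then have "(\<lambda>n. (1/2) ^ k / fact k * (b n * sqrt (pi * real n) * sqrt (real (n + k) / real n))) \<longlonglongrightarrow> (1/2) ^ k / fact k * 1"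
      by (intro tendsto_mult tendsto_const) simp
    moreover have "eventually (\<lambda>n. (1/2) ^ k / fact k * (b n * sqrt (pi * real n) * sqrt (real (n + k) / real n)) = a k (n + k)) at_top"
      using eventually_gt_at_top[of 0]
    proof eventually_elim
      case (elim n)
      have "sqrt (pi * real n) * sqrt (real (n + k) / real n) = sqrt (pi * real (n + k))"
        using elim by (simp flip: real_sqrt_mult)
      then show ?case by (simp add: a_def mult.assoc)
    qed
    ultimately have "(\<lambda>n. a k (n + k)) \<longlonglongrightarrow> (1/2) ^ k / fact k * 1"
      by (rule Lim_transform_eventually)
    then show ?thesis by (simp add: LIMSEQ_offset[where k = k])
  qed
  have bound: "norm (a k n) \<le> sqrt pi * (1 / fact k)" for k n
  proof (cases "k \<le> n")
    case True
    then obtain m where n: "n = k + m" using le_Suc_ex by blast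
    have "b m * sqrt (pi * real n) \<le> 1 / sqrt (real m + 1) * sqrt (pi * real n)"
      unfolding b_def by (intro mult_right_mono central_binomial_le) auto
    also have "\<dots> = sqrt pi * sqrt (real n / (real m + 1))"
      by (simp add: real_sqrt_mult real_sqrt_divide)
    \<comment> \<open>The loss from replacing \<open>n - k\<close> by \<open>n\<close> is at most
      \<open>k + 1 \<le> 2^k\<close>, which \<open>(1/2)^k\<close> absorbs; a summable multiple of
      \<open>1 / k!\<close> remains.\<close>
    also have "\<dots> \<le> sqrt pi * (real k + 1)"
    proof -
      have "real n \<le> (real k + 1) * (real m + 1)" by (simp add: n algebra_simps)
      also have "\<dots> \<le> (real k + 1)\<^sup>2 * (real m + 1)"
        by (intro mult_right_mono) (auto simp: power2_eq_square algebra_simps)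
      finally have "real n / (real m + 1) \<le> (real k + 1)\<^sup>2" by (simp add: divide_le_eq)
      then have "sqrt (real n / (real m + 1)) \<le> real k + 1" by (intro real_le_lsqrt) auto
      then show ?thesis by (intro mult_left_mono) auto
    qed
    finally have *: "b m * sqrt (pi * real n) \<le> sqrt pi * (real k + 1)" .
    have "real k + 1 \<le> 2 ^ k"
    proof -
      have "k + 1 \<le> 2 ^ k" by (induction k) auto
      then have "real (k + 1) \<le> real (2 ^ k)" by (simp only: of_nat_le_iff)
      then show ?thesis by simp
    qed
    then have "sqrt pi * (real k + 1) \<le> sqrt pi * 2 ^ k" by (intro mult_left_mono) auto
    with * have "b m * sqrt (pi * real n) \<le> sqrt pi * 2 ^ k" by linarith
    then have "(1/2) ^ k / fact k * (b m * sqrt (pi * real n)) \<le> (1/2) ^ k / fact k * (sqrt pi * 2 ^ k)"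
      by (rule mult_left_mono) simp
    also have "\<dots> = sqrt pi * (1 / fact k)" by (simp add: power_divide)
    finally have "a k n \<le> sqrt pi * (1 / fact k)" by (simp add: a_def n mult.assoc)
    moreover have "a k n \<ge> 0" by (simp add: a_def b_def)
    ultimately show ?thesis by simp
  qed (simp add: a_def)
  have summ: "summable (\<lambda>k. sqrt pi * (1 / fact k))"
    by (intro summable_mult) (use summable_exp[of "1 :: real"] in \<open>simp add: divide_inverse\<close>)
  have ev: "eventually (\<lambda>(k, n). norm (a k n) \<le> sqrt pi * (1 / fact k)) (at_top \<times>\<^sub>F sequentially)"
    using bound by (auto intro: always_eventually)
  have "(\<lambda>n. suminf (\<lambda>k. a k n)) \<longlonglongrightarrow> (\<Sum>k. (1/2) ^ k / fact k)"
    using tannerys_theorem[OF lim ev summ sequentially_bot] by blast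
  moreover have "(\<Sum>k. (1/2) ^ k / fact k) = exp (1/2 :: real)"
  proof -
    have "(\<lambda>k. (1/2) ^ k / fact k) = (\<lambda>k. (1/2 :: real) ^ k /\<^sub>R fact k)"
      by (rule ext) (simp add: field_simps)
    then show ?thesis using exp_converges[of "1/2 :: real"] by (metis sums_unique)
  qed
  moreover have "suminf (\<lambda>k. a k n) = bethe_sum_2 n * sqrt (pi * real n)" for n
  proof -
    have "suminf (\<lambda>k. a k n) = (\<Sum>k\<le>n. a k n)"
      by (intro suminf_finite) (auto simp: a_def)
    then show ?thesis by (simp add: a_def b_def bethe_sum_2_def sum_distrib_right)
  qed
  ultimately show ?thesis by simp
qed

lemma root_4_eq_sqrt_sqrt: "root 4 x = sqrt (sqrt x)"
  using real_root_mult_exp[of 2 2 x] by (simp add: sqrt_def)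

lemma permanent_div_bethe_perm_deg_2_all_one:
  "(\<lambda>n. permanent (all_one_mat n) / bethe_perm_deg 2 (all_one_mat n)) \<sim>[at_top]
     (\<lambda>n. root 4 (pi * real n / exp 1))"
proof (rule asymp_equivI')
  \<comment> \<open>The factor \<open>fact n\<close> cancels in the quotient and leaves
    \<open>1 / sqrt (bethe_sum_2 n)\<close>; the square root of \<open>sqrt (pi * n)\<close> is the
    fourth root in the claim.\<close>
  have "(\<lambda>n. 1 / sqrt (bethe_sum_2 n * sqrt (pi * real n) / exp (1/2))) \<longlonglongrightarrow> 1 / sqrt (exp (1/2) / exp (1/2))"
    by (intro tendsto_intros bethe_sum_2_asymp) auto
  moreover have "1 / sqrt (bethe_sum_2 n * sqrt (pi * real n) / exp (1/2)) =
      permanent (all_one_mat n) / bethe_perm_deg 2 (all_one_mat n) / root 4 (pi * real n / exp 1)" for n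
  proof -
    have "sqrt (exp 1) = exp (1/2 :: real)"
      by (simp add: real_sqrt_unique power2_eq_square flip: exp_add)
    then show ?thesis
      by (simp add: permanent_all_one bethe_perm_deg_2_all_one root_4_eq_sqrt_sqrt real_sqrt_mult real_sqrt_divide)
  qed
  ultimately show "(\<lambda>n. permanent (all_one_mat n) / bethe_perm_deg 2 (all_one_mat n) / root 4 (pi * real n / exp 1)) \<longlonglongrightarrow> 1"
    by simp
qed

theorem theorem3:
  shows "((\<lambda>n. permanent (all_one_mat n) / bethe_perm (all_one_mat n))
           \<sim>[at_top] (\<lambda>n. sqrt (2 * pi * real n / exp 1)))
       \<and> ((\<lambda>n. permanent (all_one_mat n) / bethe_perm_deg 2 (all_one_mat n))
           \<sim>[at_top] (\<lambda>n. root 4 (pi * real n / exp 1)))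
       \<and> ((\<lambda>n. bethe_perm_deg 2 (all_one_mat n) / bethe_perm (all_one_mat n))
           \<sim>[at_top] (\<lambda>n. sqrt 2 * root 4 (pi * real n / exp 1)))"
proof (intro conjI)
  note 1 = permanent_div_bethe_perm_all_one and 2 = permanent_div_bethe_perm_deg_2_all_one
  show "(\<lambda>n. permanent (all_one_mat n) / bethe_perm (all_one_mat n)) \<sim>[at_top] (\<lambda>n. sqrt (2 * pi * real n / exp 1))"
    by (rule 1)
  show "(\<lambda>n. permanent (all_one_mat n) / bethe_perm_deg 2 (all_one_mat n)) \<sim>[at_top] (\<lambda>n. root 4 (pi * real n / exp 1))"
    by (rule 2)
  \<comment> \<open>The third quotient is the first divided by the second, as \<open>fact n\<close>
    is nonzero.\<close>
  have "(permanent (all_one_mat n) / bethe_perm (all_one_mat n)) / (permanent (all_one_mat n) / bethe_perm_deg 2 (all_one_mat n)) =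
      bethe_perm_deg 2 (all_one_mat n) / bethe_perm (all_one_mat n)" for n
    by (simp add: permanent_all_one)
  moreover have "sqrt (2 * pi * real n / exp 1) / root 4 (pi * real n / exp 1) = sqrt 2 * root 4 (pi * real n / exp 1)" for n
  proof -
    \<comment> \<open>One of two equal fourth roots cancels. At \<open>n = 0\<close> both sides of
      the quotient identity are 0 because \<open>x / 0 = 0\<close>.\<close>
    have "sqrt (pi * real n / exp 1) = root 4 (pi * real n / exp 1) * root 4 (pi * real n / exp 1)"
      by (simp add: root_4_eq_sqrt_sqrt)
    then have "sqrt (2 * pi * real n / exp 1) = sqrt 2 * (root 4 (pi * real n / exp 1) * root 4 (pi * real n / exp 1))"
      by (metis real_sqrt_mult mult.assoc times_divide_eq_right)
    then show ?thesis by simp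
  qed
  ultimately show "(\<lambda>n. bethe_perm_deg 2 (all_one_mat n) / bethe_perm (all_one_mat n)) \<sim>[at_top]
      (\<lambda>n. sqrt 2 * root 4 (pi * real n / exp 1))"
    using asymp_equiv_divide[OF 1 2] by simp
qed

end
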